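(* A finite group $G$ has the strong CFS property if and only if $G$ is isomorphic to one of the following groups: (1) the trivial group; (2) a cyclic group of prime order; (3) one of the groups $C_2^2$, $C_4$, $C_2^3$, $C_3^2$.
   Context: Here $C_n$ denotes the cyclic group of order $n$, and $C_n^k$ the direct product of $k$ copies of $C_n$. For subsets $A, B$ of a group $G$, put $AB := \{ab \mid a \in A, b \in B\}$. The product $AB$ is called direct, and is then denoted $A \cdot B$, if for every $x \in AB$ there is exactly one pair $(a,b) \in A \times B$ with $x = ab$; thus $G = A \cdot B$ means that $G = AB$ and the product $AB$ is direct (for finite $G$: $G = AB$ and $|G| = |A||B|$). A subset $A \subseteq G$ is a left factor of $G$ if there is a subset $B \subseteq G$ with $G = A \cdot B$, and a right factor of $G$ if there is a subset $B \subseteq G$ with $G = B \cdot A$. $A$ is a factor of $G$ if it is a left factor or a right factor of $G$. A subset $A$ of a finite group $G$ is a Lagrange subset if $|A|$ divides $|G|$. A finite group $G$ has the strong CFS property if every Lagrange subset of $G$ is a factor of $G$. *)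

theory Defs
  imports "HOL-Algebra.Algebra"
begin

definition direct_product :: "('a, 'b) monoid_scheme \<Rightarrow> 'a set \<Rightarrow> 'a set \<Rightarrow> bool" where
  "direct_product G A B \<longleftrightarrow>
     (\<forall>x \<in> A <#>\<^bsub>G\<^esub> B. \<exists>!p. p \<in> A \<times> B \<and> x = fst p \<otimes>\<^bsub>G\<^esub> snd p)"

definition factorization :: "('a, 'b) monoid_scheme \<Rightarrow> 'a set \<Rightarrow> 'a set \<Rightarrow> bool" where
  "factorization G A B \<longleftrightarrow> carrier G = A <#>\<^bsub>G\<^esub> B \<and> direct_product G A B"

definition left_factor :: "('a, 'b) monoid_scheme \<Rightarrow> 'a set \<Rightarrow> bool" where
  "left_factor G A \<longleftrightarrow> A \<subseteq> carrier G \<and> (\<exists>B \<subseteq> carrier G. factorization G A B)"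

definition right_factor :: "('a, 'b) monoid_scheme \<Rightarrow> 'a set \<Rightarrow> bool" where
  "right_factor G A \<longleftrightarrow> A \<subseteq> carrier G \<and> (\<exists>B \<subseteq> carrier G. factorization G B A)"

definition group_factor :: "('a, 'b) monoid_scheme \<Rightarrow> 'a set \<Rightarrow> bool" where
  "group_factor G A \<longleftrightarrow> left_factor G A \<or> right_factor G A"

text \<open>\<open>Lagrange_subset\<close> and \<open>strong_CFS\<close> are meant for finite groups only: on infinite sets both
  \<^const>\<open>card\<close> and \<^const>\<open>order\<close> are 0.\<close>

definition Lagrange_subset :: "('a, 'b) monoid_scheme \<Rightarrow> 'a set \<Rightarrow> bool" where
  "Lagrange_subset G A \<longleftrightarrow> A \<subseteq> carrier G \<and> card A dvd order G"

definition strong_CFS :: "('a, 'b) monoid_scheme \<Rightarrow> bool" where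
  "strong_CFS G \<longleftrightarrow> (\<forall>A. Lagrange_subset G A \<longrightarrow> group_factor G A)"

end

theory Submission
  imports Defs "HOL-Number_Theory.Residues"
begin

text \<open>
  If \<open>G = A \<cdot> B\<close> with \<open>A\<close> contained in a subgroup \<open>H\<close>, then \<open>H = A \<cdot> (B \<inter> H)\<close>, so \<open>card A\<close> divides
  \<open>card H\<close>. In a group with the strong CFS property, any divisor \<open>d\<close> of the group order with
  \<open>d \<le> card H\<close> therefore divides \<open>card H\<close>. Applied to subgroups of prime order, this shows that
  the order of a nontrivial such group is a prime power \<open>p ^ a\<close>
  (\<open>strong_CFS_prime_power_order\<close>).

  The main tool is a perturbation of a proper subgroup \<open>H\<close>: a minority \<open>S\<close> of its elements is
  exchanged for a set \<open>T\<close> of as many elements outside \<open>H\<close>. If the result is a left factor with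
  complement \<open>B\<close>, then \<open>B\<close> is a transversal of the right cosets of \<open>H\<close>, and if \<open>T\<close> lies in a single
  right coset, each translate of \<open>T\<close> by an element of \<open>B\<close> fills the hole left by \<open>S\<close> in one coset
  (\<open>perturbed_subgroup_factor\<close>). Two instances are used. Exchanging \<open>\<one>\<close> for \<open>x\<close>, when
  \<open>card H \<ge> 3\<close>, shows that \<open>H\<close> contains no nontrivial power of an element \<open>x\<close> outside \<open>H\<close>
  (\<open>strong_CFS_power_in_subgroup\<close>). Exchanging \<open>{\<one>, s}\<close> for \<open>{g, t \<otimes> g}\<close>, when \<open>card H \<ge> 5\<close> and
  \<open>t \<otimes> g = g \<otimes> u\<close> with \<open>t, u \<in> H\<close>, shows that every \<open>s \<in> H\<close> is among \<open>\<one>, t, inv t, u, inv u\<close>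
  (\<open>strong_CFS_conjugate_in_subgroup\<close>).

  A subgroup of index \<open>p\<close> in a group of order \<open>p ^ a\<close>, \<open>a \<ge> 2\<close>, admits such \<open>t\<close> and \<open>u\<close> by a
  counting argument, so it has at most five elements; for order 25 the elements \<open>t\<close> and \<open>g\<close> can
  be chosen to commute, which excludes this case. Thus the order is 1, a prime, 4, 8 or 9
  (\<open>strong_CFS_order\<close>). The obstruction for one exchanged element forces exponent 2 in order 8
  and, together with a commuting pair, an elementary abelian group in order 9.

  Conversely, a Lagrange subset of one of the listed groups can be translated to contain \<open>\<one>\<close>.
  It is then either a subgroup or a transversal of an explicit subgroup.
\<close>

section \<open>Factorizations and left factors\<close>

lemma factorization_unique:
  assumes "factorization G A B" "a \<in> A" "b \<in> B" "a' \<in> A" "b' \<in> B"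
    and "a \<otimes>\<^bsub>G\<^esub> b = a' \<otimes>\<^bsub>G\<^esub> b'"
  shows "a = a' \<and> b = b'"
proof -
  have "a \<otimes>\<^bsub>G\<^esub> b \<in> A <#>\<^bsub>G\<^esub> B"
    using assms by (auto simp: set_mult_def)
  then have "\<exists>!p. p \<in> A \<times> B \<and> a \<otimes>\<^bsub>G\<^esub> b = fst p \<otimes>\<^bsub>G\<^esub> snd p"
    using assms(1) unfolding factorization_def direct_product_def by blast
  moreover have "(a, b) \<in> A \<times> B \<and> a \<otimes>\<^bsub>G\<^esub> b = fst (a, b) \<otimes>\<^bsub>G\<^esub> snd (a, b)"
    "(a', b') \<in> A \<times> B \<and> a \<otimes>\<^bsub>G\<^esub> b = fst (a', b') \<otimes>\<^bsub>G\<^esub> snd (a', b')"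
    using assms by auto
  ultimately have "(a, b) = (a', b')" by blast
  then show ?thesis by simp
qed

lemma factorization_exists:
  assumes "factorization G A B" "x \<in> carrier G"
  obtains a b where "a \<in> A" "b \<in> B" "x = a \<otimes>\<^bsub>G\<^esub> b"
  using assms unfolding factorization_def set_mult_def by auto

lemma factorizationI:
  assumes "\<And>a b. a \<in> A \<Longrightarrow> b \<in> B \<Longrightarrow> a \<otimes>\<^bsub>G\<^esub> b \<in> carrier G"
    and "\<And>x. x \<in> carrier G \<Longrightarrow> \<exists>a\<in>A. \<exists>b\<in>B. x = a \<otimes>\<^bsub>G\<^esub> b"
    and "\<And>a b a' b'. \<lbrakk>a \<in> A; b \<in> B; a' \<in> A; b' \<in> B; a \<otimes>\<^bsub>G\<^esub> b = a' \<otimes>\<^bsub>G\<^esub> b'\<rbrakk> \<Longrightarrow> a = a' \<and> b = b'"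
  shows "factorization G A B"
proof -
  have "carrier G = A <#>\<^bsub>G\<^esub> B"
    using assms(1,2) unfolding set_mult_def by blast
  moreover have "direct_product G A B"
    unfolding direct_product_def
  proof
    fix x assume "x \<in> A <#>\<^bsub>G\<^esub> B"
    then obtain a b where ab: "a \<in> A" "b \<in> B" "x = a \<otimes>\<^bsub>G\<^esub> b"
      by (auto simp: set_mult_def)
    show "\<exists>!p. p \<in> A \<times> B \<and> x = fst p \<otimes>\<^bsub>G\<^esub> snd p"
    proof (rule ex1I[of _ "(a, b)"])
      fix p assume "p \<in> A \<times> B \<and> x = fst p \<otimes>\<^bsub>G\<^esub> snd p"
      then show "p = (a, b)"
        using assms(3)[of "fst p" "snd p" a b] ab by (metis mem_Times_iff prod.collapse)
    qed (use ab in auto)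
  qed
  ultimately show ?thesis by (simp add: factorization_def)
qed

lemma factorization_card:
  assumes "factorization G A B"
  shows "card A * card B = order G"
proof -
  have "inj_on (\<lambda>(a, b). a \<otimes>\<^bsub>G\<^esub> b) (A \<times> B)"
    using factorization_unique[OF assms] by (auto simp: inj_on_def)
  moreover have "(\<lambda>(a, b). a \<otimes>\<^bsub>G\<^esub> b) ` (A \<times> B) = carrier G"
    using assms by (auto simp: factorization_def set_mult_def)
  ultimately show ?thesis
    by (metis card_cartesian_product card_image order_def)
qed

context group
begin

lemma factorization_inv:
  assumes "A \<subseteq> carrier G" "B \<subseteq> carrier G" "factorization G A B"
  shows "factorization G (m_inv G ` B) (m_inv G ` A)"
proof (rule factorizationI)
  fix x assume x: "x \<in> carrier G"
  obtain a b where "a \<in> A" "b \<in> B" "inv x = a \<otimes> b"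
    using factorization_exists[OF assms(3), of "inv x"] x by auto
  then show "\<exists>b\<in>m_inv G ` B. \<exists>a\<in>m_inv G ` A. x = b \<otimes> a"
    using assms(1,2) x by (metis image_eqI inv_inv inv_mult_group subsetD)
next
  fix b a b' a'
  assume "b \<in> m_inv G ` B" "a \<in> m_inv G ` A" "b' \<in> m_inv G ` B" "a' \<in> m_inv G ` A"
    and eq: "b \<otimes> a = b' \<otimes> a'"
  then obtain c d c' d' where *: "c \<in> B" "b = inv c" "d \<in> A" "a = inv d"
      "c' \<in> B" "b' = inv c'" "d' \<in> A" "a' = inv d'"
    by auto
  then have "inv (d \<otimes> c) = inv (d' \<otimes> c')"
    using eq assms(1,2) by (metis inv_mult_group subsetD)
  then have "d \<otimes> c = d' \<otimes> c'"
    using * assms(1,2) by (metis inv_inv m_closed subsetD)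
  then show "b = b' \<and> a = a'"
    using factorization_unique[OF assms(3)] * by blast
qed (use assms in auto)

text \<open>Inversion reverses products, so a right factor is the inverse of a left factor. Every
  obstruction below is therefore proved for left factors only and then applied both to a set and
  to its set of inverses.\<close>

lemma group_factor_cases:
  assumes "group_factor G A"
  shows "left_factor G A \<or> left_factor G (m_inv G ` A)"
proof (cases "left_factor G A")
  case False
  then obtain B where "A \<subseteq> carrier G" "B \<subseteq> carrier G" "factorization G B A"
    using assms by (auto simp: group_factor_def right_factor_def)
  then have "left_factor G (m_inv G ` A)"
    unfolding left_factor_def
    using factorization_inv[of B A] by (intro conjI exI[of _ "m_inv G ` B"]) auto
  then show ?thesis ..
qed simp

section \<open>Prime power order\<close>

text \<open>If \<open>A \<subseteq> H\<close> and \<open>G = A \<cdot> B\<close>, then a product \<open>a \<otimes> b\<close> lies in \<open>H\<close> exactly when \<open>b\<close> does;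
  hence \<open>H = A \<cdot> (B \<inter> H)\<close>.\<close>

lemma card_dvd_subgroup_of_left_factor:
  assumes "subgroup H G" "A \<subseteq> H" "left_factor G A"
  shows "card A dvd card H"
proof -
  interpret H: subgroup H G by fact
  obtain B where B: "B \<subseteq> carrier G" "factorization G A B"
    using assms(3) by (auto simp: left_factor_def)
  have "factorization (G\<lparr>carrier := H\<rparr>) A (B \<inter> H)"
  proof (rule factorizationI)
    fix x assume "x \<in> carrier (G\<lparr>carrier := H\<rparr>)"
    then have x: "x \<in> H" by simp
    obtain a b where ab: "a \<in> A" "b \<in> B" "x = a \<otimes> b"
      using factorization_exists[OF B(2), of x] x by auto
    then have "b = inv a \<otimes> x"
      using assms(2) B(1) x by (metis H.mem_carrier inv_solve_left' subsetD)
    then have "b \<in> H"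
      using ab(1) x assms(2) by auto
    then show "\<exists>a\<in>A. \<exists>b\<in>B \<inter> H. x = a \<otimes>\<^bsub>G\<lparr>carrier := H\<rparr>\<^esub> b"
      using ab by auto
  qed (use assms(2) factorization_unique[OF B(2)] in auto)
  from factorization_card[OF this] have "card H = card A * card (B \<inter> H)"
    by (simp add: order_def)
  then show ?thesis by simp
qed

lemma strong_CFSD:
  "\<lbrakk>strong_CFS G; A \<subseteq> carrier G; card A dvd order G\<rbrakk> \<Longrightarrow> group_factor G A"
  by (simp add: strong_CFS_def Lagrange_subset_def)

text \<open>Any \<open>d\<close> elements of \<open>H\<close> form a Lagrange subset of \<open>G\<close>, hence a factor of \<open>G\<close>.\<close>

lemma strong_CFS_dvd_card_subgroup:
  assumes "strong_CFS G" "finite (carrier G)" "subgroup H G" "d dvd order G" "d \<le> card H"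
  shows "d dvd card H"
proof -
  interpret H: subgroup H G by fact
  obtain A where A: "A \<subseteq> H" "card A = d"
    using obtain_subset_with_card_n[OF assms(5)] by auto
  have "group_factor G A"
    using assms(1,4) A H.subset by (auto simp: strong_CFS_def Lagrange_subset_def)
  moreover have "m_inv G ` A \<subseteq> H" "card (m_inv G ` A) = card A"
    using A H.subset inj_on_subset[OF inv_inj] by (auto intro!: card_image)
  ultimately show ?thesis
    using group_factor_cases card_dvd_subgroup_of_left_factor[OF assms(3)] A by metis
qed

text \<open>Of two primes dividing the order, the smaller one must divide the order of a subgroup
  whose order is the larger one, so they are equal.\<close>

lemma strong_CFS_prime_power_order:
  assumes "strong_CFS G" "finite (carrier G)" "order G > 1"
  obtains p a where "Factorial_Ring.prime (p::nat)" "a > 0" "order G = p ^ a"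
proof -
  have same: "p = q" if "p \<le> q" "Factorial_Ring.prime p" "Factorial_Ring.prime q" "p dvd order G" "q dvd order G" for p q :: nat
  proof -
    obtain m where "order G = q ^ 1 * m" using \<open>q dvd order G\<close> by auto
    then obtain H where "subgroup H G" "card H = q ^ 1"
      using sylow_thm[OF \<open>Factorial_Ring.prime q\<close> is_group _ assms(2)] by blast
    then have "p dvd q"
      using strong_CFS_dvd_card_subgroup[OF assms(1,2), of H p] that by simp
    then show "p = q" using that primes_dvd_imp_eq by blast
  qed
  obtain p where p: "Factorial_Ring.prime p" "p dvd order G"
    using prime_factor_nat[of "order G"] assms(3) by auto
  obtain m where m: "order G = p ^ multiplicity p (order G) * m" "\<not> p dvd m"
    using multiplicity_decompose'[of "order G" p] p assms(3) by (metis not_one_less_zero not_prime_unit)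
  have "m = 1"
  proof (rule ccontr)
    assume "m \<noteq> 1"
    then obtain q where q: "Factorial_Ring.prime q" "q dvd m"
      using prime_factor_nat by auto
    have "q dvd order G" using q(2) by (subst m(1)) simp
    then have "p = q" using same[of p q] same[of q p] p q by (metis nat_le_linear)
    then show False using q m by simp
  qed
  moreover have "multiplicity p (order G) > 0"
    using p assms(3) by (simp add: prime_multiplicity_gt_zero_iff)
  ultimately show thesis using that p m by simp
qed

section \<open>Perturbed subgroups as factors\<close>

text \<open>Here \<open>H\<close> is altered by exchanging fewer than half of its elements, the set \<open>S\<close>, for a set
  \<open>T\<close> outside \<open>H\<close>. Each \<open>b \<in> B\<close> translates the altered set so that it fills more than half of the
  coset \<open>H #> b\<close>, hence no right coset contains two elements of \<open>B\<close>; as the altered set has the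
  size of \<open>H\<close>, counting shows that \<open>B\<close> meets every right coset exactly once. In the coset of
  \<open>b' \<in> B\<close> only the hole \<open>S #> b'\<close> is left over, and if \<open>T\<close> lies within one right coset of \<open>H\<close>,
  then \<open>T #> b\<close> must fit into a single such hole.\<close>

lemma perturbed_subgroup_factor:
  assumes "finite (carrier G)" "subgroup H G" "S \<subseteq> H" "T \<subseteq> carrier G" "T \<inter> H = {}"
    and "card T = card S" "2 * card S < card H"
    and B: "B \<subseteq> carrier G" "factorization G ((H - S) \<union> T) B"
  shows "\<And>b b'. \<lbrakk>b \<in> B; b' \<in> B; b' \<in> H #> b\<rbrakk> \<Longrightarrow> b = b'"
    and "\<And>g b. \<lbrakk>g \<in> carrier G; b \<in> B; T \<subseteq> H #> g\<rbrakk> \<Longrightarrow>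
           \<exists>b'\<in>B. \<forall>t\<in>T. \<exists>s\<in>S. t \<otimes> b = s \<otimes> b'"
proof -
  interpret H: subgroup H G by fact
  have fin: "finite H" "finite S" "finite T"
    using assms(1,3,4) H.subset finite_subset by metis+
  show transversal: "b = b'" if b: "b \<in> B" "b' \<in> B" "b' \<in> H #> b" for b b'
  proof -
    obtain h where h: "h \<in> H" "b' = h \<otimes> b"
      using b(3) by (auto simp: r_coset_def)
    let ?X = "(\<lambda>k. k \<otimes> h) ` (H - S)"
    have "inj_on (\<lambda>k. k \<otimes> h) (H - S)"
      using h by (auto simp: inj_on_def)
    then have card: "card ?X = card H - card S" "card (H - S) = card H - card S"
      using assms(3) fin by (auto simp: card_image card_Diff_subset)
    \<comment> \<open>Two subsets of \<open>H\<close>, each with more than half of its elements, intersect.\<close>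
    have "?X \<inter> (H - S) \<noteq> {}"
    proof
      assume "?X \<inter> (H - S) = {}"
      then have "card (?X \<union> (H - S)) = 2 * (card H - card S)"
        using card fin by (subst card_Un_disjoint) auto
      moreover have "card (?X \<union> (H - S)) \<le> card H"
        using h by (intro card_mono fin) auto
      ultimately show False using assms(7) by linarith
    qed
    then obtain k k' where k: "k \<in> H - S" "k' \<in> H - S" "k \<otimes> h = k'" by auto
    then have "k \<otimes> b' = k' \<otimes> b"
      using h b B(1) by (simp add: m_assoc[symmetric] subset_iff)
    then show ?thesis
      using factorization_unique[OF B(2), of k b' k' b] k b by simp
  qed
  show "\<exists>b'\<in>B. \<forall>t\<in>T. \<exists>s\<in>S. t \<otimes> b = s \<otimes> b'"
    if g: "g \<in> carrier G" "b \<in> B" "T \<subseteq> H #> g" for g b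
  proof -
    have bG: "b \<in> carrier G" using g B by auto
    have "card ((H - S) \<union> T) = card H"
      using assms(3,5,6,7) fin by (subst card_Un_disjoint) (auto simp: card_Diff_subset)
    then have "card H * card B = card H * card (rcosets H)"
      using factorization_card[OF B(2)] lagrange[OF assms(2)] by (simp add: mult.commute)
    then have "card B = card (rcosets H)"
      using assms(7) by simp
    moreover have inj: "inj_on (\<lambda>b. H #> b) B"
      using transversal B(1) rcos_self[OF _ assms(2)] by (auto simp: inj_on_def)
    moreover have "finite (rcosets H)"
      using assms(1) rcosets_part_G[OF assms(2)] by (metis finite_UnionD)
    moreover have "(\<lambda>b. H #> b) ` B \<subseteq> rcosets H"
      using B(1) rcosetsI[OF H.subset] by auto
    \<comment> \<open>\<open>B\<close> represents as many cosets as there are, hence all of them.\<close>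
    ultimately have "(\<lambda>b. H #> b) ` B = rcosets H"
      by (metis card_image card_subset_eq)
    then obtain b' where b': "b' \<in> B" "H #> (g \<otimes> b) = H #> b'"
      using rcosetsI[OF H.subset, of "g \<otimes> b"] g bG by (metis imageE m_closed)
    have "\<exists>s\<in>S. t \<otimes> b = s \<otimes> b'" if t: "t \<in> T" for t
    proof -
      have "t \<otimes> b \<in> H #> (g \<otimes> b)"
        using g t bG by (auto simp: r_coset_def m_assoc)
      then obtain h where h: "h \<in> H" "t \<otimes> b = h \<otimes> b'"
        using b' by (auto simp: r_coset_def)
      have "h \<in> S"
      proof (rule ccontr)
        \<comment> \<open>In this case \<open>h \<otimes> b'\<close> is already covered by an element of \<open>H - S\<close>.\<close>
        assume "h \<notin> S"
        then have "t = h"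
          using factorization_unique[OF B(2), of t b h b'] h t b' g by auto
        then show False using t h assms(5) by auto
      qed
      then show ?thesis using h by blast
    qed
    then show ?thesis using b' by blast
  qed
qed

text \<open>The hole in a coset is just the representative \<open>b' \<in> B\<close>, so left multiplication by \<open>x\<close> maps
  \<open>B\<close> into \<open>B\<close>. A power of \<open>x\<close> that lies in \<open>H\<close> also preserves every right coset of \<open>H\<close>, hence
  fixes the elements of \<open>B\<close>.\<close>

lemma left_factor_replace_one:
  assumes "finite (carrier G)" "subgroup H G" "3 \<le> card H" "x \<in> carrier G" "x \<notin> H"
    and "left_factor G ((H - {\<one>}) \<union> {x})" "x [^] (k::nat) \<in> H"
  shows "x [^] k = \<one>"
proof -
  interpret H: subgroup H G by fact
  obtain B where B: "B \<subseteq> carrier G" "factorization G ((H - {\<one>}) \<union> {x}) B"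
    using assms(6) by (auto simp: left_factor_def)
  have *: "{\<one>} \<subseteq> H" "{x} \<subseteq> carrier G" "{x} \<inter> H = {}" "card {x} = card {\<one>}" "2 * card {\<one>} < card H"
    "{x} \<subseteq> H #> x"
    using assms by (auto simp: rcos_self)
  have step: "x \<otimes> b \<in> B" if "b \<in> B" for b
    using perturbed_subgroup_factor(2)[OF assms(1,2) *(1-5) B assms(4) that *(6)] B(1) by auto
  obtain b where b: "b \<in> B"
    using factorization_exists[OF B(2) one_closed] by blast
  have "x [^] n \<otimes> b \<in> B" for n :: nat
  proof (induction n)
    case (Suc n)
    then show ?case
      using step[OF Suc] b B(1) assms(4) by (metis m_assoc nat_pow_Suc2 nat_pow_closed subsetD)
  qed (use b B(1) in auto)
  moreover have "x [^] k \<otimes> b \<in> H #> b"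
    using assms(7) by (auto simp: r_coset_def)
  ultimately have "b = x [^] k \<otimes> b"
    using perturbed_subgroup_factor(1)[OF assms(1,2) *(1-5) B] b by blast
  then show ?thesis
    using b B(1) assms(4) by (simp add: subset_iff)
qed

text \<open>The pair \<open>{g \<otimes> b, t \<otimes> g \<otimes> b}\<close> must coincide with a hole \<open>{b', s \<otimes> b'}\<close>; the quotient of
  the two elements is \<open>t\<close> on one side and \<open>s\<close> or \<open>inv s\<close> on the other.\<close>

lemma left_factor_replace_two:
  assumes "finite (carrier G)" "subgroup H G" "5 \<le> card H"
    and "s \<in> H" "s \<noteq> \<one>" "g \<in> carrier G" "g \<notin> H" "t \<in> H" "t \<noteq> \<one>"
    and "left_factor G ((H - {\<one>, s}) \<union> {g, t \<otimes> g})"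
  shows "s \<in> {t, inv t}"
proof -
  interpret H: subgroup H G by fact
  obtain B where B: "B \<subseteq> carrier G" "factorization G ((H - {\<one>, s}) \<union> {g, t \<otimes> g}) B"
    using assms(10) by (auto simp: left_factor_def)
  have "t \<otimes> g \<notin> H"
    using assms(6-8) by (metis H.m_closed H.m_inv_closed H.mem_carrier inv_solve_left)
  moreover have "t \<otimes> g \<noteq> g"
    using assms(6,8,9) by (metis H.mem_carrier r_cancel_one)
  moreover have "{g, t \<otimes> g} \<subseteq> H #> g"
    using assms(6,8) rcos_self[OF _ assms(2)] by (auto simp: r_coset_def)
  ultimately have *: "{\<one>, s} \<subseteq> H" "{g, t \<otimes> g} \<subseteq> carrier G" "{g, t \<otimes> g} \<inter> H = {}"
    "card {g, t \<otimes> g} = card {\<one>, s}" "2 * card {\<one>, s} < card H" "{g, t \<otimes> g} \<subseteq> H #> g"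
    using assms by auto
  obtain b where b: "b \<in> B"
    using factorization_exists[OF B(2) one_closed] by blast
  then obtain b' where b': "b' \<in> B" "g \<otimes> b = \<one> \<otimes> b' \<or> g \<otimes> b = s \<otimes> b'"
     "t \<otimes> g \<otimes> b = \<one> \<otimes> b' \<or> t \<otimes> g \<otimes> b = s \<otimes> b'"
    using perturbed_subgroup_factor(2)[OF assms(1,2) *(1-5) B assms(6) b *(6)] by auto
  have G: "b \<in> carrier G" "b' \<in> carrier G" "t \<in> carrier G" "s \<in> carrier G" "g \<in> carrier G"
    using b b' B(1) assms by auto
  have "t \<otimes> (g \<otimes> b) \<noteq> g \<otimes> b"
    using G assms(9) by (metis m_closed r_cancel_one)
  with b' G consider "g \<otimes> b = b'" "t \<otimes> (g \<otimes> b) = s \<otimes> b'" | "g \<otimes> b = s \<otimes> b'" "t \<otimes> (g \<otimes> b) = b'"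
    by (auto simp: m_assoc)
  then show ?thesis
  proof cases
    case 1
    then show ?thesis using G by simp
  next
    case 2
    then have "(t \<otimes> s) \<otimes> b' = b'" using G by (simp add: m_assoc)
    then have "t \<otimes> s = \<one>" using G by (metis m_closed r_cancel_one)
    then show ?thesis using G by (metis inv_closed inv_equality inv_inv insertCI)
  qed
qed

lemma subgroup_inv_image_Diff:
  assumes "subgroup H G" "S \<subseteq> H"
  shows "m_inv G ` (H - S) = H - m_inv G ` S"
proof -
  interpret H: subgroup H G by fact
  have "m_inv G ` H = H"
  proof
    show "H \<subseteq> m_inv G ` H"
      by (metis H.m_inv_closed H.mem_carrier image_eqI inv_inv subsetI)
  qed auto
  moreover have "inj_on (m_inv G) (H \<union> S)"
    using inj_on_subset[OF inv_inj] assms H.subset by auto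
  ultimately show ?thesis
    using assms(2) by (metis inj_on_image_set_diff Un_upper1 Un_upper2 Diff_subset sup.order_iff sup_commute)
qed

text \<open>The set of inverses of \<open>H\<close> with \<open>\<one>\<close> exchanged for \<open>x\<close> is \<open>H\<close> with \<open>\<one>\<close> exchanged for
  \<open>inv x\<close>, so left and right factors are excluded alike.\<close>

lemma strong_CFS_power_in_subgroup:
  assumes "strong_CFS G" "finite (carrier G)" "subgroup H G" "3 \<le> card H"
    and "x \<in> carrier G" "x \<notin> H" "x [^] (k::nat) \<in> H"
  shows "x [^] k = \<one>"
proof -
  interpret H: subgroup H G by fact
  let ?A = "(H - {\<one>}) \<union> {x}"
  have fin: "finite H" using assms(2) H.subset finite_subset by blast
  have "card ?A = card H"
    using assms(4,6) fin by (subst card_Un_disjoint) auto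
  moreover have "card H dvd order G"
    using lagrange[OF assms(3)] by (metis dvd_triv_right)
  ultimately have "group_factor G ?A"
    using assms(1,5) H.subset by (intro strong_CFSD) auto
  moreover have "m_inv G ` ?A = (H - {\<one>}) \<union> {inv x}"
    using subgroup_inv_image_Diff[OF assms(3), of "{\<one>}"] by (simp add: image_Un)
  ultimately consider "left_factor G ?A" | "left_factor G ((H - {\<one>}) \<union> {inv x})"
    using group_factor_cases by metis
  then show ?thesis
  proof cases
    case 1
    then show ?thesis using left_factor_replace_one assms by blast
  next
    case 2
    have "inv x \<notin> H" using assms(5,6) by (metis H.m_inv_closed inv_inv)
    moreover have "inv x [^] k \<in> H" using assms(5,7) by (simp add: nat_pow_inv)
    ultimately have "inv x [^] k = \<one>"
      using left_factor_replace_one[OF assms(2,3,4) _ _ 2] assms(5) by simp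
    then show ?thesis using assms(5) by (simp add: nat_pow_inv)
  qed
qed

text \<open>The relation \<open>t \<otimes> g = g \<otimes> u\<close> puts the new elements \<open>g\<close> and \<open>t \<otimes> g\<close> into one right coset
  and also into one left coset of \<open>H\<close>, so the obstruction for pairs applies to the perturbed
  subgroup and to its set of inverses. With \<open>5 \<le> card H\<close>, the two exchanged elements are fewer
  than half.\<close>

lemma strong_CFS_conjugate_in_subgroup:
  assumes "strong_CFS G" "finite (carrier G)" "subgroup H G" "5 \<le> card H"
    and "g \<in> carrier G" "g \<notin> H" "t \<in> H" "t \<noteq> \<one>" "u \<in> H" "t \<otimes> g = g \<otimes> u"
  shows "H \<subseteq> {\<one>, t, inv t, u, inv u}"
proof
  interpret H: subgroup H G by fact
  fix s assume s: "s \<in> H"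
  show "s \<in> {\<one>, t, inv t, u, inv u}"
  proof (cases "s = \<one>")
    case False
    let ?A = "(H - {\<one>, s}) \<union> {g, t \<otimes> g}"
    have G: "t \<in> carrier G" "u \<in> carrier G" "s \<in> carrier G" using assms s by auto
    have "u \<noteq> \<one>"
      using assms(5,8,10) G by (metis r_cancel_one r_one)
    have fin: "finite H" using assms(2) H.subset finite_subset by blast
    have "t \<otimes> g \<notin> H"
      using assms(5-7) by (metis H.m_closed H.m_inv_closed H.mem_carrier inv_solve_left)
    moreover have "t \<otimes> g \<noteq> g"
      using assms(5,8) G by (metis r_cancel_one)
    ultimately have "card ?A = card H"
      using assms(4,6) fin False s by (subst card_Un_disjoint) (auto simp: card_Diff_subset)
    moreover have "card H dvd order G"
      using lagrange[OF assms(3)] by (metis dvd_triv_right)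
    ultimately have "group_factor G ?A"
      using assms(1,5) G H.subset by (intro strong_CFSD) auto
    moreover have "m_inv G ` ?A = (H - {\<one>, inv s}) \<union> {inv g, inv u \<otimes> inv g}"
      using subgroup_inv_image_Diff[OF assms(3), of "{\<one>, s}"] s assms(5,10) G
      by (simp add: image_Un inv_mult_group)
    ultimately consider "left_factor G ?A"
      | "left_factor G ((H - {\<one>, inv s}) \<union> {inv g, inv u \<otimes> inv g})"
      using group_factor_cases by metis
    then show ?thesis
    proof cases
      case 1
      then show ?thesis
        using left_factor_replace_two[OF assms(2-4) s False assms(5-8)] by auto
    next
      case 2
      have "inv g \<notin> H" using assms(5,6) by (metis H.m_inv_closed inv_inv)
      moreover have "inv u \<noteq> \<one>" "inv s \<noteq> \<one>" using \<open>u \<noteq> \<one>\<close> False G by simp_all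
      ultimately have "inv s \<in> {inv u, inv (inv u)}"
        using left_factor_replace_two[OF assms(2-4) _ _ _ _ _ _ 2] s assms(5,9) by auto
      then show ?thesis using G by (metis insertCI insertE inv_inv singletonD)
    qed
  qed simp
qed

section \<open>Bounding the order\<close>

text \<open>The conclusion says that \<open>H\<close> meets its conjugate by \<open>g\<close> nontrivially. Otherwise the products
  \<open>h \<otimes> g \<otimes> k\<close> with \<open>h, k \<in> H\<close> would be distinct; they all lie outside \<open>H\<close>, where there is too
  little room for \<open>card H * card H\<close> elements.\<close>

lemma large_subgroup_meets_conjugate:
  assumes "finite (carrier G)" "subgroup H G" "order G \<le> card H * card H"
    and "g \<in> carrier G" "g \<notin> H"
  obtains t u where "t \<in> H" "u \<in> H" "t \<noteq> \<one>" "t \<otimes> g = g \<otimes> u"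
proof -
  interpret H: subgroup H G by fact
  let ?f = "\<lambda>(h, k). h \<otimes> g \<otimes> k"
  have notin: "h \<otimes> g \<otimes> k \<notin> H" if "h \<in> H" "k \<in> H" for h k
  proof
    assume "h \<otimes> g \<otimes> k \<in> H"
    moreover have "g = inv h \<otimes> (h \<otimes> g \<otimes> k) \<otimes> inv k"
      using that assms(4) by (simp add: m_assoc inv_solve_left)
    ultimately show False
      using that assms(5) by (metis H.m_closed H.m_inv_closed)
  qed
  have "?f ` (H \<times> H) \<subseteq> carrier G - {\<one>}"
  proof (rule image_subsetI)
    fix p assume "p \<in> H \<times> H"
    then obtain h k where p: "p = (h, k)" "h \<in> H" "k \<in> H" by auto
    have "h \<otimes> g \<otimes> k \<noteq> \<one>"
      using notin[OF p(2,3)] H.one_closed by metis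
    then show "?f p \<in> carrier G - {\<one>}"
      using p assms(4) by simp
  qed
  then have "card (?f ` (H \<times> H)) \<le> order G - 1"
    using card_mono[of "carrier G - {\<one>}"] assms(1) by (simp add: order_def)
  moreover have "order G > 0" using assms(1) by (simp add: order_gt_0_iff_finite)
  ultimately have "card (?f ` (H \<times> H)) < card (H \<times> H)"
    using assms(3) by (simp add: card_cartesian_product)
  then have "\<not> inj_on ?f (H \<times> H)"
    by (metis card_image less_irrefl)
  then obtain h k h' k' where *: "h \<in> H" "k \<in> H" "h' \<in> H" "k' \<in> H" "(h, k) \<noteq> (h', k')"
      "h \<otimes> g \<otimes> k = h' \<otimes> g \<otimes> k'"
    by (auto simp: inj_on_def)
  then have G: "h \<in> carrier G" "k \<in> carrier G" "h' \<in> carrier G" "k' \<in> carrier G" by auto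
  have "inv h' \<otimes> (h \<otimes> g \<otimes> k) \<otimes> inv k = inv h' \<otimes> (h' \<otimes> g \<otimes> k') \<otimes> inv k"
    using *(6) by simp
  then have eq: "(inv h' \<otimes> h) \<otimes> g = g \<otimes> (k' \<otimes> inv k)"
    using G assms(4) by (simp add: m_assoc inv_solve_left')
  have "inv h' \<otimes> h \<noteq> \<one>"
  proof
    assume "inv h' \<otimes> h = \<one>"
    then have "h = h'"
      using G by (metis inv_closed inv_equality inv_inv)
    then have "k = k'"
      using *(6) G assms(4) by simp
    with \<open>h = h'\<close> show False
      using *(5) by simp
  qed
  with that eq * show thesis by (meson H.m_closed H.m_inv_closed)
qed

lemma nat_pow_commute_twist:
  assumes "t \<in> carrier G" "g \<in> carrier G" "t \<otimes> g = g \<otimes> t [^] (j::nat)"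
  shows "t \<otimes> g [^] (m::nat) = g [^] m \<otimes> t [^] (j ^ m)"
proof (induction m)
  case (Suc m)
  have pow: "t [^] i \<otimes> g = g \<otimes> t [^] (j * i)" for i :: nat
  proof (induction i)
    case (Suc i)
    have "t [^] Suc i \<otimes> g = t [^] i \<otimes> (t \<otimes> g)"
      using assms(1,2) by (simp add: m_assoc)
    also have "\<dots> = (t [^] i \<otimes> g) \<otimes> t [^] j"
      using assms by (simp add: m_assoc)
    also have "\<dots> = g \<otimes> t [^] (j * Suc i)"
      using Suc assms(1,2) by (simp add: m_assoc nat_pow_mult add.commute)
    finally show ?case .
  qed (use assms in simp)
  have "t \<otimes> g [^] Suc m = (t \<otimes> g [^] m) \<otimes> g"
    using assms(1,2) by (simp add: m_assoc)
  also have "\<dots> = g [^] m \<otimes> (t [^] (j ^ m) \<otimes> g)"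
    using Suc assms(1,2) by (simp add: m_assoc)
  also have "\<dots> = g [^] Suc m \<otimes> t [^] (j ^ Suc m)"
    using pow assms(1,2) by (simp add: m_assoc)
  finally show ?case .
qed (use assms in simp)

lemma nat_pow_cong_ord:
  assumes "x \<in> carrier G" "[m = n] (mod ord x)"
  shows "x [^] m = x [^] n"
proof -
  have "int (ord x) dvd int n - int m"
    using assms(2) by (metis cong_int_iff cong_iff_dvd_diff cong_sym_eq)
  then show ?thesis
    using int_pow_eq[OF assms(1), of "int m" "int n"] by (simp add: int_pow_int)
qed

lemma prime_subgroup_generated_by_nontrivial:
  assumes "subgroup H G" "Factorial_Ring.prime (card H)" "t \<in> H" "t \<noteq> \<one>"
  shows "ord t = card H" "generate G {t} = H"
proof -
  interpret H: subgroup H G by fact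
  interpret HG: group "G\<lparr>carrier := H\<rparr>" by (rule H.subgroup_is_group[OF is_group])
  have fin: "finite H" using assms(2) by (metis card.infinite not_prime_0)
  have t: "t \<in> carrier G" using assms by auto
  have sub: "generate G {t} \<subseteq> H"
    using generate_subgroup_incl[of "{t}" H] assms by auto
  have "t [^] card H = \<one>"
    using HG.pow_order_eq_1[of t] assms(3) by (simp add: order_def nat_pow_consistent[symmetric])
  then have "ord t dvd card H" using t by (simp add: pow_eq_id)
  moreover have "ord t \<noteq> 1" using pow_ord_eq_1[OF t] t assms(4) by force
  ultimately show "ord t = card H"
    using assms(2) by (metis prime_nat_iff)
  then show "generate G {t} = H"
    using sub fin generate_pow_card[OF t] by (metis card_subset_eq)
qed

lemma power_prime_power_cong:
  assumes "Factorial_Ring.prime (p::nat)"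
  shows "[j ^ (p ^ k) = j] (mod p)"
proof (induction k)
  case (Suc k)
  have frob: "[i ^ p = i] (mod p)" for i
  proof (cases "p dvd i")
    case True
    then have "p dvd i ^ p" using assms by (simp add: prime_gt_0_nat dvd_power_le dvd_trans[OF _ dvd_power])
    then show ?thesis using True by (metis cong_0_iff cong_sym cong_trans)
  next
    case False
    have "i ^ p = i ^ (p - 1) * i"
      using assms by (metis Suc_diff_1 power_Suc2 prime_gt_0_nat)
    then show ?thesis
      using cong_mult[OF fermat_theorem[OF assms False] cong_refl[of i]] by simp
  qed
  have "j ^ (p ^ Suc k) = (j ^ (p ^ k)) ^ p"
    by (simp add: power_mult[symmetric] mult.commute)
  then show ?case using frob Suc by (metis cong_trans)
qed simp

text \<open>Conjugation by \<open>g\<close> sends a generator \<open>t\<close> of \<open>H\<close> to a power \<open>t [^] j\<close>. Iterating it \<open>p\<^sup>2\<close>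
  times is the identity, because \<open>p\<^sup>2\<close> is the order of the group, and yields the exponent \<open>j\<close>
  raised to \<open>p\<^sup>2\<close>, which is congruent to \<open>j\<close> modulo \<open>p\<close> by Fermat. Hence \<open>t [^] j = t\<close>.\<close>

lemma prime_square_order_commute:
  assumes "finite (carrier G)" "Factorial_Ring.prime p" "order G = p ^ 2" "subgroup H G" "card H = p"
    and "g \<in> carrier G" "g \<notin> H"
  obtains t where "t \<in> H" "t \<noteq> \<one>" "t \<otimes> g = g \<otimes> t"
proof -
  obtain t u where tu: "t \<in> H" "u \<in> H" "t \<noteq> \<one>" "t \<otimes> g = g \<otimes> u"
    using large_subgroup_meets_conjugate[OF assms(1,4) _ assms(6,7)] assms(3,5)
    by (metis order_refl power2_eq_square)
  have t: "t \<in> carrier G" "ord t = p" "generate G {t} = H"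
    using prime_subgroup_generated_by_nontrivial[OF assms(4) _ tu(1,3)] tu(1) assms(2,4,5)
    by (auto dest: subgroup.mem_carrier)
  then have "ord t \<noteq> 0" using assms(2) by auto
  then obtain j :: nat where j: "u = t [^] j"
    using generate_pow_nat[OF t(1)] t(3) tu(2) by auto
  have "t \<otimes> g [^] (p ^ 2) = g [^] (p ^ 2) \<otimes> t [^] (j ^ (p ^ 2))"
    using nat_pow_commute_twist t(1) assms(6) tu(4) j by blast
  then have "t = t [^] (j ^ (p ^ 2))"
    using pow_order_eq_1[OF assms(6)] assms(3) t(1) by simp
  also have "\<dots> = u"
    using nat_pow_cong_ord[OF t(1)] power_prime_power_cong[OF assms(2)] t(2) j by simp
  finally show thesis using that tu by metis
qed

text \<open>In a group of order \<open>p ^ a\<close> with \<open>a \<ge> 2\<close>, a subgroup \<open>H\<close> of index \<open>p\<close> is large enough to meet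
  its conjugates. If it has at least five elements, it is covered by \<open>{\<one>, t, inv t, u, inv u}\<close>,
  which leaves only \<open>card H = 5\<close>, hence order 25; there \<open>t\<close> can be chosen to commute with \<open>g\<close>, so
  that \<open>u = t\<close> and the cover has only three elements. Hence \<open>p ^ (a - 1) \<le> 4\<close>.\<close>

lemma strong_CFS_order:
  assumes "strong_CFS G" "finite (carrier G)"
  shows "order G = 1 \<or> Factorial_Ring.prime (order G) \<or> order G \<in> {4, 8, 9}"
proof (cases "order G > 1")
  case True
  then obtain p a where pa: "Factorial_Ring.prime (p::nat)" "a > 0" "order G = p ^ a"
    using strong_CFS_prime_power_order[OF assms] by metis
  have p2: "p \<ge> 2" using pa(1) prime_ge_2_nat by blast
  show ?thesis
  proof (cases "a = 1")
    case False
    define c where "c = a - 2"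
    have a: "a = c + 2" using False pa(2) by (simp add: c_def)
    have "order G = p ^ Suc c * p" using pa a by simp
    then obtain H where H: "subgroup H G" "card H = p ^ Suc c"
      using sylow_thm[OF pa(1) is_group _ assms(2)] by blast
    interpret H: subgroup H G by (rule H(1))
    have "p ^ Suc c < order G" using pa a p2 by simp
    then obtain g where g: "g \<in> carrier G" "g \<notin> H"
      using H H.subset by (metis less_irrefl order_def subsetI subset_antisym)
    have "p ^ Suc c \<le> 4"
    proof (rule ccontr)
      assume "\<not> p ^ Suc c \<le> 4"
      then have five: "5 \<le> card H" using H by simp
      have bound: False if "t \<in> H" "u \<in> H" "t \<noteq> \<one>" "t \<otimes> g = g \<otimes> u" "card {\<one>, t, inv t, u, inv u} < card H" for t u
        using strong_CFS_conjugate_in_subgroup[OF assms H(1) five g that(1,3,2,4)] that(5)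
          card_mono[of "{\<one>, t, inv t, u, inv u}" H] by simp
      have "card H * card H \<ge> order G"
        using pa a H p2 by (simp add: power_add[symmetric] power_increasing)
      then obtain t u where tu: "t \<in> H" "u \<in> H" "t \<noteq> \<one>" "t \<otimes> g = g \<otimes> u"
        using large_subgroup_meets_conjugate[OF assms(2) H(1) _ g] by metis
      have "card {\<one>, t, inv t, u, inv u} \<le> 5"
        by (simp add: card_insert_if)
      moreover have "\<not> card {\<one>, t, inv t, u, inv u} < card H" using bound[OF tu] by blast
      ultimately have "card H = 5" using five by linarith
      then have p5: "p = 5 \<and> c = 0"
      proof -
        assume "card H = 5"
        then have "p dvd 5" using H(2) by (metis dvd_triv_left power_Suc)
        moreover have "Factorial_Ring.prime (5::nat)" by simp
        ultimately have "p = 5" using pa(1) primes_dvd_imp_eq by blast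
        then show ?thesis using H(2) \<open>card H = 5\<close> by simp
      qed
      then obtain t where t: "t \<in> H" "t \<noteq> \<one>" "t \<otimes> g = g \<otimes> t"
        using prime_square_order_commute[OF assms(2) pa(1) _ H(1) _ g] pa(3) a H(2) by auto
      have "card {\<one>, t, inv t, t, inv t} \<le> 3"
        by (simp add: card_insert_if)
      then have "card {\<one>, t, inv t, t, inv t} < card H" using five by linarith
      then show False using bound[OF t(1,1,2,3)] by blast
    qed
    moreover have "p * 2 ^ c \<le> p ^ Suc c" using p2 by (simp add: power_mono)
    ultimately have "p * 2 ^ c \<le> 4" by linarith
    moreover have "2 * 2 ^ c \<le> p * 2 ^ c" using p2 by simp
    ultimately have "2 * 2 ^ c \<le> (4::nat)" by linarith
    then have "c < 2"
      using power_increasing[of 2 c "2::nat"] by (cases "c \<ge> 2") auto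
    then consider "c = 0" | "c = 1" by linarith
    then show ?thesis
    proof cases
      case 1
      then have "p \<in> {2,3,4}" using p2 \<open>p ^ Suc c \<le> 4\<close> by auto
      moreover have "\<not> Factorial_Ring.prime (4::nat)" by simp
      ultimately show ?thesis using 1 a pa by auto
    next
      case 2
      then have "p = 2" using p2 \<open>p * 2 ^ c \<le> 4\<close> by simp
      then show ?thesis using 2 a pa by simp
    qed
  qed (use pa in simp)
next
  case False
  moreover have "order G > 0" using assms(2) by (simp add: order_gt_0_iff_finite)
  ultimately show ?thesis by simp
qed

section \<open>Small subgroups and groups of order eight\<close>

lemma involutions_commute:
  assumes "\<And>x. x \<in> carrier G \<Longrightarrow> x \<otimes> x = \<one>" "x \<in> carrier G" "y \<in> carrier G"
  shows "x \<otimes> y = y \<otimes> x"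
  using assms by (metis inv_equality inv_mult_group m_closed)

lemma subgroup_two:
  assumes "x \<in> carrier G" "x \<otimes> x = \<one>"
  shows "subgroup {\<one>, x} G"
  by (rule subgroupI) (use assms inv_equality in auto)

lemma subgroup_klein:
  assumes "x \<in> carrier G" "y \<in> carrier G" "x \<otimes> x = \<one>" "y \<otimes> y = \<one>" "x \<otimes> y = y \<otimes> x"
  shows "subgroup {\<one>, x, y, x \<otimes> y} G"
proof (rule subgroupI)
  have *: "x \<otimes> (x \<otimes> z) = z" "y \<otimes> (y \<otimes> z) = z" "x \<otimes> (y \<otimes> z) = y \<otimes> (x \<otimes> z)" if "z \<in> carrier G" for z
    using assms that by (simp_all add: m_assoc[symmetric])
  have i: "inv x = x" "inv y = y" using assms inv_equality by auto
  show "inv a \<in> {\<one>, x, y, x \<otimes> y}" if "a \<in> {\<one>, x, y, x \<otimes> y}" for a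
    using that assms i by (auto simp: inv_mult_group)
  show "a \<otimes> b \<in> {\<one>, x, y, x \<otimes> y}" if "a \<in> {\<one>, x, y, x \<otimes> y}" "b \<in> {\<one>, x, y, x \<otimes> y}" for a b
    using that assms * by (auto simp: m_assoc)
qed (use assms in auto)

lemma subgroup_three:
  assumes "x \<in> carrier G" "x \<otimes> (x \<otimes> x) = \<one>"
  shows "subgroup {\<one>, x, x \<otimes> x} G"
proof (rule subgroupI)
  have i: "inv x = x \<otimes> x" "inv (x \<otimes> x) = x"
    using assms by (auto intro!: inv_equality simp: m_assoc)
  show "inv a \<in> {\<one>, x, x \<otimes> x}" if "a \<in> {\<one>, x, x \<otimes> x}" for a
    using that i by auto
  show "a \<otimes> b \<in> {\<one>, x, x \<otimes> x}" if "a \<in> {\<one>, x, x \<otimes> x}" "b \<in> {\<one>, x, x \<otimes> x}" for a b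
    using that assms by (auto simp: m_assoc)
qed (use assms in auto)

text \<open>A subgroup \<open>H\<close> of order 4 contains all squares, so the elements outside \<open>H\<close> are involutions
  by the obstruction for one exchanged element. If \<open>x \<in> H\<close> had order 4, then \<open>x \<otimes> x\<close> would commute
  with an involution \<open>g\<close> outside \<open>H\<close>, and the Klein four-group generated by \<open>x \<otimes> x\<close> and \<open>g\<close> would
  contain \<open>x \<otimes> x\<close> but not \<open>x\<close>, against the same obstruction.\<close>

lemma strong_CFS_order_8_exponent:
  assumes "strong_CFS G" "finite (carrier G)" "order G = 8" "x \<in> carrier G"
  shows "x \<otimes> x = \<one>"
proof -
  have "order G = 2 ^ 2 * 2" using assms(3) by simp
  then obtain H where H: "subgroup H G" "card H = 2 ^ 2"
    using sylow_thm[OF two_is_prime_nat is_group _ assms(2)] by blast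
  interpret H: subgroup H G by (rule H(1))
  have fin: "finite H" using assms(2) H.subset finite_subset by blast
  have square: "y \<otimes> y \<in> H" if y: "y \<in> carrier G" for y
  proof (rule ccontr)
    assume n: "y \<otimes> y \<notin> H"
    \<comment> \<open>The coset \<open>?C\<close> is the whole complement of \<open>H\<close>, but it cannot contain \<open>y \<otimes> y\<close>.\<close>
    let ?C = "(\<lambda>h. y \<otimes> h) ` H"
    have "y \<notin> H" using n by auto
    have disj: "?C \<inter> H = {}"
    proof -
      have "y \<otimes> h \<notin> H" if "h \<in> H" for h
        using that y \<open>y \<notin> H\<close> by (metis H.m_closed H.m_inv_closed H.mem_carrier inv_solve_right)
      then show ?thesis by auto
    qed
    moreover have "card ?C = 4"
      using H(2) y by (subst card_image) (auto simp: inj_on_def)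
    ultimately have "card (?C \<union> H) = 8"
      using H(2) fin by (subst card_Un_disjoint) auto
    moreover have "?C \<union> H \<subseteq> carrier G" using y by auto
    ultimately have "?C \<union> H = carrier G"
      using assms(2,3) by (metis card_subset_eq order_def)
    then have "y \<otimes> y \<in> ?C" using n y by auto
    then show False using \<open>y \<notin> H\<close> y by auto
  qed
  have outside: "y \<otimes> y = \<one>" if y: "y \<in> carrier G" "y \<notin> H" for y
    using strong_CFS_power_in_subgroup[OF assms(1,2) H(1) _ y, of 2] H(2) square y(1)
    by (simp add: numeral_2_eq_2)
  show ?thesis
  proof (rule ccontr)
    assume n: "x \<otimes> x \<noteq> \<one>"
    then have x: "x \<in> H" using outside assms(4) by blast
    have "card H \<noteq> order G" using H(2) assms(3) by simp
    then obtain g where g: "g \<in> carrier G" "g \<notin> H"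
      using H.subset by (metis order_def subsetI subset_antisym)
    have gh: "g \<otimes> h \<notin> H" if "h \<in> H" for h
      using that g by (metis H.m_closed H.m_inv_closed H.mem_carrier inv_solve_right)
    let ?z = "x \<otimes> x"
    interpret HG: group "G\<lparr>carrier := H\<rparr>" by (rule H.subgroup_is_group[OF is_group])
    have "x [^] (4::nat) = \<one>"
      using HG.pow_order_eq_1[of x] x H(2) by (simp add: order_def nat_pow_consistent[symmetric])
    then have zz: "?z \<otimes> ?z = \<one>"
      using assms(4) by (simp add: numeral_eq_Suc m_assoc)
    have gg: "g \<otimes> g = \<one>" "(g \<otimes> ?z) \<otimes> (g \<otimes> ?z) = \<one>"
      using outside[of g] outside[of "g \<otimes> ?z"] gh[of ?z] g x assms(4) by auto
    have "?z \<otimes> g = g \<otimes> ?z"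
    proof -
      have "inv (g \<otimes> ?z) = g \<otimes> ?z" "inv g = g" "inv ?z = ?z"
        using gg zz g(1) assms(4) inv_equality by auto
      then show ?thesis using g(1) assms(4) by (metis inv_mult_group m_closed)
    qed
    then have K: "subgroup {\<one>, g, ?z, g \<otimes> ?z} G"
      using subgroup_klein[of g ?z] gg zz g assms(4) by simp
    have "x \<notin> {\<one>, g, ?z, g \<otimes> ?z}"
      using n x g gh[of ?z] assms(4) by auto
    moreover have "card {\<one>, g, ?z, g \<otimes> ?z} \<ge> 3"
    proof -
      have "g \<noteq> \<one>" "g \<noteq> ?z" using g x by auto
      then have "card {\<one>, g, ?z} = 3" using n by auto
      then show ?thesis using card_mono[of "{\<one>, g, ?z, g \<otimes> ?z}" "{\<one>, g, ?z}"] by simp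
    qed
    ultimately have "x [^] (2::nat) = \<one>"
      using strong_CFS_power_in_subgroup[OF assms(1,2) K _ assms(4), of 2] assms(4)
      by (simp add: numeral_2_eq_2)
    then show False using n assms(4) by (simp add: numeral_2_eq_2)
  qed
qed

section \<open>Isomorphism types of small groups\<close>

lemma int_pow_mod_ord:
  assumes "x \<in> carrier G" "ord x = n"
  shows "x [^] ((i::int) mod int n) = x [^] i"
  using int_pow_eq[OF assms(1), of "i mod int n" i] assms(2) by (simp add: minus_mod_eq_mult_div)

lemma int_pow_commutes:
  assumes "x \<otimes> y = y \<otimes> x" "x \<in> carrier G" "y \<in> carrier G"
  shows "x [^] (i::int) \<otimes> y = y \<otimes> x [^] i"
proof -
  have nat: "x [^] (n::nat) \<otimes> y = y \<otimes> x [^] n" for n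
    using group_commutes_pow[OF assms] .
  have inv: "inv (x [^] n) \<otimes> y = y \<otimes> inv (x [^] n)" for n :: nat
  proof -
    have "x [^] n \<otimes> y \<otimes> inv (x [^] n) = y"
      using assms(2,3) by (simp add: nat m_assoc)
    then have "x [^] n \<otimes> (y \<otimes> inv (x [^] n)) = y"
      using assms(2,3) by (simp add: m_assoc)
    then show ?thesis
      using assms(2,3) inv_solve_left'[of "y \<otimes> inv (x [^] n)" "x [^] n" y] by simp
  qed
  show ?thesis
  proof (cases i rule: int_cases2)
    case (nonneg n)
    then show ?thesis using nat[of n] by (simp only: int_pow_int)
  next
    case (nonpos n)
    then show ?thesis using inv[of n] assms(2) by (simp only: int_pow_neg int_pow_int)
  qed
qed

text \<open>An embedded copy of \<open>K\<close> that commutes with \<open>g\<close> and shares only \<open>\<one>\<close> with the powers of \<open>g\<close>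
  gives an injective homomorphism sending \<open>(i, k)\<close> to \<open>g [^] i \<otimes> \<phi> k\<close>; it is onto by counting.\<close>

lemma cyclic_times_hom:
  assumes "finite (carrier G)" "group K" "\<phi> \<in> hom K G" "inj_on \<phi> (carrier K)"
    and "g \<in> carrier G" "ord g = n" "order G = n * order K"
    and comm: "\<And>k. k \<in> carrier K \<Longrightarrow> \<phi> k \<otimes> g = g \<otimes> \<phi> k"
    and indep: "\<And>i::int. g [^] i \<in> \<phi> ` carrier K \<Longrightarrow> g [^] i = \<one>"
  shows "G \<cong> integer_mod_group n \<times>\<times> K"
proof -
  interpret K: group K by fact
  interpret \<phi>: group_hom K G \<phi>
    using assms(3) by (simp add: group_hom_def group_hom_axioms_def is_group K.is_group)
  have n: "n > 0"
    using ord_ge_1[OF assms(1,5)] assms(6) by simp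
  let ?C = "integer_mod_group n \<times>\<times> K"
  let ?f = "\<lambda>(i, k). g [^] (i::int) \<otimes> \<phi> k"
  have comm': "\<phi> k \<otimes> g [^] (i::int) = g [^] i \<otimes> \<phi> k" if "k \<in> carrier K" for k i
    using int_pow_commutes[OF comm[OF that, symmetric]] that assms(5) by simp
  have "?f \<in> hom ?C G"
  proof (rule homI)
    fix x y assume "x \<in> carrier ?C" "y \<in> carrier ?C"
    then obtain i k j l where *: "x = (i, k)" "y = (j, l)" "k \<in> carrier K" "l \<in> carrier K" by auto
    have "?f (x \<otimes>\<^bsub>?C\<^esub> y) = (g [^] i \<otimes> g [^] j) \<otimes> (\<phi> k \<otimes> \<phi> l)"
      using * assms(5) int_pow_mod_ord[OF assms(5,6)] by (simp add: int_pow_mult)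
    also have "\<dots> = g [^] i \<otimes> (\<phi> k \<otimes> g [^] j) \<otimes> \<phi> l"
      using * assms(5) comm' by (simp add: m_assoc)
    also have "\<dots> = ?f x \<otimes> ?f y"
      using * assms(5) by (simp add: m_assoc)
    finally show "?f (x \<otimes>\<^bsub>?C\<^esub> y) = ?f x \<otimes> ?f y" .
  qed (use assms(5) in auto)
  moreover have inj: "inj_on ?f (carrier ?C)"
  proof (rule inj_onI)
    fix x y assume "x \<in> carrier ?C" "y \<in> carrier ?C" and eq: "?f x = ?f y"
    then obtain i k j l where *: "x = (i, k)" "y = (j, l)" "k \<in> carrier K" "l \<in> carrier K"
      "i \<in> {0..<int n}" "j \<in> {0..<int n}"
      using n by (auto simp: carrier_integer_mod_group)
    have "g [^] (i - j) = g [^] i \<otimes> inv (g [^] j)"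
      using assms(5) by (simp add: int_pow_diff)
    also have "\<dots> = \<phi> l \<otimes> inv (\<phi> k)"
    proof -
      have "g [^] i = g [^] j \<otimes> \<phi> l \<otimes> inv (\<phi> k)"
        using eq * assms(5) by (simp add: inv_solve_right)
      also have "\<dots> = \<phi> l \<otimes> inv (\<phi> k) \<otimes> g [^] j"
        using comm'[of "l \<otimes>\<^bsub>K\<^esub> inv\<^bsub>K\<^esub> k" j] * assms(5) by (simp add: m_assoc)
      finally show ?thesis
        using * assms(5) by (simp add: inv_solve_right')
    qed
    also have "\<dots> = \<phi> (l \<otimes>\<^bsub>K\<^esub> inv\<^bsub>K\<^esub> k)"
      using * by simp
    finally have 1: "g [^] (i - j) = \<phi> (l \<otimes>\<^bsub>K\<^esub> inv\<^bsub>K\<^esub> k)" .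
    then have "g [^] (i - j) = \<one>"
      using indep * by blast
    then have "int n dvd i - j"
      using int_pow_eq_id[OF assms(5)] assms(6) by simp
    then have "i = j"
      using * by (simp add: mod_eq_dvd_iff[symmetric])
    then have "\<phi> k = \<phi> l"
      using eq * assms(5) by simp
    then show "x = y"
      using * \<open>i = j\<close> assms(4) by (auto dest: inj_onD)
  qed
  moreover have "?f ` carrier ?C = carrier G"
  proof (rule card_subset_eq[OF assms(1)])
    show "?f ` carrier ?C \<subseteq> carrier G"
      using assms(5) by auto
    have "card (?f ` carrier ?C) = card (carrier ?C)"
      by (rule card_image[OF inj])
    then show "card (?f ` carrier ?C) = card (carrier G)"
      using assms(7) n by (simp add: card_cartesian_product carrier_integer_mod_group order_def)
  qed
  ultimately have "?f \<in> iso ?C G"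
    by (simp add: iso_def bij_betw_def)
  moreover have "group ?C"
    by (intro DirProd_group group_integer_mod_group assms(2))
  ultimately show ?thesis
    by (metis group.iso_sym is_isoI)
qed

lemma cyclic_hom:
  assumes "x \<in> carrier G" "ord x = n" "n > 0"
  shows "(\<lambda>i::int. x [^] i) \<in> hom (integer_mod_group n) G"
    and "inj_on (\<lambda>i::int. x [^] i) (carrier (integer_mod_group n))"
proof -
  show "(\<lambda>i::int. x [^] i) \<in> hom (integer_mod_group n) G"
    using assms(1) int_pow_mod_ord[OF assms(1,2)] by (intro homI) (auto simp: int_pow_mult)
  show "inj_on (\<lambda>i::int. x [^] i) (carrier (integer_mod_group n))"
    using assms int_pow_eq[OF assms(1)]
    by (auto simp: inj_on_def carrier_integer_mod_group mod_eq_dvd_iff[symmetric])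
qed

lemma cyclic_iso:
  assumes "finite (carrier G)" "x \<in> carrier G" "ord x = order G"
  shows "G \<cong> integer_mod_group (order G)"
proof -
  have pos: "order G > 0" using assms(1) by (simp add: order_gt_0_iff_finite)
  note * = cyclic_hom[OF assms(2,3) pos]
  let ?f = "\<lambda>i::int. x [^] i"
  have "?f ` carrier (integer_mod_group (order G)) = carrier G"
  proof (rule card_subset_eq[OF assms(1)])
    show "?f ` carrier (integer_mod_group (order G)) \<subseteq> carrier G"
      using assms(2) by auto
    show "card (?f ` carrier (integer_mod_group (order G))) = card (carrier G)"
      using card_image[OF *(2)] pos by (simp add: carrier_integer_mod_group order_def)
  qed
  then have "?f \<in> iso (integer_mod_group (order G)) G"
    using * by (simp add: iso_def bij_betw_def)
  then show ?thesis
    by (metis group.iso_sym group_integer_mod_group is_isoI)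
qed

lemma ord_prime_eq:
  assumes "Factorial_Ring.prime p" "x \<in> carrier G" "x \<noteq> \<one>" "x [^] (p::nat) = \<one>"
  shows "ord x = p"
proof -
  have "ord x dvd p" using assms by (simp add: pow_eq_id)
  moreover have "ord x \<noteq> 1" using pow_ord_eq_1[OF assms(2)] assms(2,3) by force
  ultimately show ?thesis using assms(1) by (metis prime_nat_iff)
qed

lemma prime_order_iso:
  assumes "finite (carrier G)" "Factorial_Ring.prime (order G)"
  shows "G \<cong> integer_mod_group (order G)"
proof -
  have "carrier G \<noteq> {\<one>}"
    using assms(2) by (auto simp: order_def)
  then obtain x where "x \<in> carrier G" "x \<noteq> \<one>" by blast
  then show ?thesis
    using ord_prime_eq[OF assms(2)] pow_order_eq_1 cyclic_iso[OF assms(1)] by metis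
qed

lemma involution_times_hom:
  assumes "finite (carrier G)" "group K" "\<phi> \<in> hom K G" "inj_on \<phi> (carrier K)"
    and sq: "\<And>x. x \<in> carrier G \<Longrightarrow> x \<otimes> x = \<one>"
    and "g \<in> carrier G" "g \<notin> \<phi> ` carrier K" "order G = 2 * order K"
  shows "G \<cong> integer_mod_group 2 \<times>\<times> K"
proof -
  have hom: "\<phi> \<one>\<^bsub>K\<^esub> = \<one>" "\<And>k. k \<in> carrier K \<Longrightarrow> \<phi> k \<in> carrier G"
    using assms(2,3) by (auto simp: hom_one hom_carrier[THEN subsetD] is_group)
  have "g \<noteq> \<one>"
    using assms(2,7) hom by (metis group.is_monoid imageI monoid.one_closed)
  then have "ord g = 2"
    using ord_prime_eq[OF two_is_prime_nat assms(6)] sq assms(6) by (simp add: numeral_2_eq_2)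
  moreover have "g [^] (i::int) = \<one>" if i: "g [^] i \<in> \<phi> ` carrier K" for i
  proof -
    have "g [^] (i mod 2) = g [^] i"
      using int_pow_mod_ord[OF assms(6) \<open>ord g = 2\<close>] by simp
    moreover have "i mod 2 = 0 \<or> i mod 2 = 1" by presburger
    moreover have "g [^] (1::int) \<notin> \<phi> ` carrier K"
      using assms(6,7) by (simp add: int_pow_1)
    ultimately show ?thesis using i by (metis int_pow_0)
  qed
  ultimately show ?thesis
    using cyclic_times_hom[OF assms(1-4,6) _ assms(8)] involutions_commute[OF sq] hom(2) assms(6)
    by metis
qed

lemma order_4_elementary_iso:
  assumes "finite (carrier G)" "order G = 4" and sq: "\<And>x. x \<in> carrier G \<Longrightarrow> x \<otimes> x = \<one>"
  shows "G \<cong> integer_mod_group 2 \<times>\<times> integer_mod_group 2"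
proof -
  have bigger: "\<exists>y\<in>carrier G. y \<notin> S" if "finite S" "card S < 4" for S
    using card_mono[OF that(1), of "carrier G"] that(2) assms(2) by (force simp: order_def)
  obtain x where x: "x \<in> carrier G" "x \<noteq> \<one>"
    using bigger[of "{\<one>}"] by auto
  have x2: "ord x = 2"
    using ord_prime_eq[OF two_is_prime_nat x] x sq by (simp add: numeral_2_eq_2)
  let ?\<phi> = "\<lambda>i::int. x [^] i"
  have card2: "card (carrier (integer_mod_group 2)) = 2"
    by (simp add: carrier_integer_mod_group)
  have "card (?\<phi> ` carrier (integer_mod_group 2)) \<le> 2"
    using card_image_le[of "carrier (integer_mod_group 2)" ?\<phi>] card2 
    by (simp add: carrier_integer_mod_group)
  moreover have "finite (?\<phi> ` carrier (integer_mod_group 2))"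
    by (simp add: carrier_integer_mod_group)
  ultimately obtain g where "g \<in> carrier G" "g \<notin> ?\<phi> ` carrier (integer_mod_group 2)"
    using bigger[of "?\<phi> ` carrier (integer_mod_group 2)"] by auto
  then show ?thesis
    using involution_times_hom[OF assms(1) group_integer_mod_group cyclic_hom[OF x(1) x2] sq]
      assms(2) card2 by (simp add: order_def)
qed

lemma order_4_iso:
  assumes "finite (carrier G)" "order G = 4"
  shows "G \<cong> integer_mod_group 4 \<or> G \<cong> integer_mod_group 2 \<times>\<times> integer_mod_group 2"
proof (cases "\<exists>x\<in>carrier G. ord x = 4")
  case True
  then show ?thesis using cyclic_iso[OF assms(1)] assms(2) by metis
next
  case False
  have "x \<otimes> x = \<one>" if x: "x \<in> carrier G" for x
  proof -
    have "ord x dvd 2 ^ 2" using ord_dvd_group_order[OF x] assms(2) by simp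
    then obtain i where "i \<le> 2" "ord x = 2 ^ i"
      using divides_primepow_nat[OF two_is_prime_nat] by blast
    then have "ord x dvd 2" using False x by (cases "i = 2") (auto simp: le_Suc_eq numeral_2_eq_2)
    then show ?thesis using x by (simp add: pow_eq_id[symmetric] numeral_2_eq_2)
  qed
  then show ?thesis using order_4_elementary_iso[OF assms] by blast
qed

lemma order_8_elementary_iso:
  assumes "finite (carrier G)" "order G = 8" and sq: "\<And>x. x \<in> carrier G \<Longrightarrow> x \<otimes> x = \<one>"
  shows "G \<cong> integer_mod_group 2 \<times>\<times> integer_mod_group 2 \<times>\<times> integer_mod_group 2"
proof -
  have "order G = 2 ^ 2 * 2" using assms(2) by simp
  then obtain H where H: "subgroup H G" "card H = 2 ^ 2"
    using sylow_thm[OF two_is_prime_nat is_group _ assms(1)] by blast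
  interpret H: subgroup H G by (rule H(1))
  interpret HG: group "G\<lparr>carrier := H\<rparr>" by (rule H.subgroup_is_group[OF is_group])
  let ?K = "integer_mod_group 2 \<times>\<times> integer_mod_group 2"
  have "G\<lparr>carrier := H\<rparr> \<cong> ?K"
    using HG.order_4_elementary_iso H assms(1) sq H.subset
    by (auto simp: order_def intro: finite_subset)
  then obtain \<phi> where "\<phi> \<in> iso ?K (G\<lparr>carrier := H\<rparr>)"
    using HG.iso_sym by (auto simp: is_iso_def)
  then have \<phi>: "\<phi> \<in> hom ?K G" "inj_on \<phi> (carrier ?K)" "\<phi> ` carrier ?K = H"
    using H.subset by (auto simp: iso_def bij_betw_def hom_def Pi_def)
  have "card H \<noteq> order G" using H(2) assms(2) by simp
  then obtain g where "g \<in> carrier G" "g \<notin> H"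
    using H.subset by (metis order_def subsetI subset_antisym)
  then show ?thesis
    using involution_times_hom[OF assms(1) _ \<phi>(1,2) sq] \<phi>(3) assms(2)
    by (simp add: DirProd_group order_def card_cartesian_product carrier_integer_mod_group)
qed

text \<open>A subgroup \<open>H\<close> of order 3 contains a nontrivial \<open>t\<close> commuting with a given \<open>g \<notin> H\<close>. By the
  obstruction for one exchanged element, \<open>H\<close> contains no nontrivial power of \<open>g\<close>; in particular
  \<open>g\<close> does not generate \<open>G\<close>, so its order is 3.\<close>

lemma strong_CFS_order_9_iso:
  assumes "strong_CFS G" "finite (carrier G)" "order G = 9"
  shows "G \<cong> integer_mod_group 3 \<times>\<times> integer_mod_group 3"
proof -
  have three: "Factorial_Ring.prime (3::nat)" by simp
  have "order G = 3 ^ 1 * 3" using assms(3) by simp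
  then obtain H where H: "subgroup H G" "card H = 3 ^ 1"
    using sylow_thm[OF three is_group _ assms(2)] by blast
  interpret H: subgroup H G by (rule H(1))
  have "card H \<noteq> order G" using H(2) assms(3) by simp
  then obtain g where g: "g \<in> carrier G" "g \<notin> H"
    using H.subset by (metis order_def subsetI subset_antisym)
  obtain t where t: "t \<in> H" "t \<noteq> \<one>" "t \<otimes> g = g \<otimes> t"
    using prime_square_order_commute[OF assms(2) three _ H(1) _ g] H(2) assms(3) by auto
  have tH: "ord t = 3" "generate G {t} = H"
    using prime_subgroup_generated_by_nontrivial[OF H(1) _ t(1,2)] H(2) by auto
  have tG: "t \<in> carrier G" using t by auto
  have indep: "g [^] i = \<one>" if "g [^] i \<in> H" for i :: nat
    using strong_CFS_power_in_subgroup[OF assms(1,2) H(1) _ g that] H(2) by simp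
  have "ord g = 3"
  proof -
    have "g \<noteq> \<one>" using g by auto
    have "ord g dvd 3 ^ 2" using ord_dvd_group_order[OF g(1)] assms(3) by simp
    then obtain i where i: "i \<le> 2" "ord g = 3 ^ i"
      using divides_primepow_nat[OF three] by blast
    have "ord g \<noteq> 9"
    proof
      assume "ord g = 9"
      then have "card (generate G {g}) = card (carrier G)"
        using generate_pow_card[OF g(1)] assms(3) by (simp add: order_def)
      then have "generate G {g} = carrier G"
        using assms(2) g(1) generate_incl[of "{g}"] by (intro card_subset_eq) auto
      then obtain k :: nat where "t = g [^] k"
        using generate_pow_nat[OF g(1)] tG \<open>ord g = 9\<close> by auto
      then show False using indep t by metis
    qed
    moreover have "ord g \<noteq> 1" using pow_ord_eq_1[OF g(1)] g(1) \<open>g \<noteq> \<one>\<close> by force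
    ultimately show ?thesis using i by (auto simp: le_Suc_eq numeral_2_eq_2)
  qed
  let ?\<phi> = "\<lambda>i::int. t [^] i"
  have "t [^] (k::int) \<otimes> g = g \<otimes> t [^] k" for k
    using int_pow_commutes[OF t(3) tG g(1)] .
  moreover have "g [^] (i::int) = \<one>" if "g [^] i \<in> ?\<phi> ` carrier (integer_mod_group 3)" for i
  proof -
    have "g [^] i \<in> H"
      using that generate_pow[OF tG] tH(2) by auto
    moreover have "g [^] nat (i mod 3) = g [^] i"
      using int_pow_mod_ord[OF g(1) \<open>ord g = 3\<close>, of i] by (simp add: int_pow_int[symmetric])
    ultimately show ?thesis using indep by metis
  qed
  ultimately show ?thesis
    using cyclic_times_hom[OF assms(2) group_integer_mod_group cyclic_hom[OF tG tH(1)] g(1) \<open>ord g = 3\<close>]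
      assms(3) by (simp add: order_def carrier_integer_mod_group)
qed

section \<open>Small groups with the strong CFS property\<close>

lemma left_factor_subgroup:
  assumes "subgroup H G"
  shows "left_factor G H"
proof -
  interpret H: subgroup H G by fact
  define r where "r R = (SOME x. x \<in> R)" for R :: "'a set"
  have r: "r R \<in> R" if "R \<in> rcosets H" for R
    using H.rcosets_non_empty[OF that] by (simp add: r_def some_in_eq)
  let ?B = "r ` (rcosets H)"
  have rG: "r R \<in> carrier G" if "R \<in> rcosets H" for R
    using r[OF that] H.rcosets_carrier[OF is_group that] by auto
  have coset: "R = H #> r R" if "R \<in> rcosets H" for R
    using that r[OF that] repr_independence[of _ H] assms by (auto simp: RCOSETS_def)
  have "factorization G H ?B"
  proof (rule factorizationI)
    fix x assume x: "x \<in> carrier G"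
    then have "H #> x \<in> rcosets H" by (rule rcosetsI[OF H.subset])
    then have "x \<in> H #> r (H #> x)" "r (H #> x) \<in> ?B"
      using coset rcos_self[OF x assms] by auto
    then show "\<exists>h\<in>H. \<exists>b\<in>?B. x = h \<otimes> b"
      unfolding r_coset_def by blast
  next
    fix a b a' b'
    assume *: "a \<in> H" "b \<in> ?B" "a' \<in> H" "b' \<in> ?B" "a \<otimes> b = a' \<otimes> b'"
    then obtain R R' where R: "R \<in> rcosets H" "b = r R" "R' \<in> rcosets H" "b' = r R'" by auto
    have "a \<otimes> b \<in> H #> b" "a' \<otimes> b' \<in> H #> b'"
      using *(1,3) by (auto simp: r_coset_def)
    then have "a \<otimes> b \<in> R" "a' \<otimes> b' \<in> R'"
      using coset R by metis+
    then have "R = R'"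
      using *(5) rcos_disjoint[OF assms] R by (metis disjnt_iff pairwiseD)
    then show "a = a' \<and> b = b'"
      using R * rG by auto
  qed (use rG in auto)
  then show ?thesis
    unfolding left_factor_def using rG H.subset by (intro conjI exI[of _ ?B]) auto
qed

text \<open>The hypothesis on quotients says that \<open>A\<close> meets every left coset of \<open>K\<close> at most once; by
  counting, it is a transversal.\<close>

lemma left_factor_transversal:
  assumes "finite (carrier G)" "subgroup K G" "A \<subseteq> carrier G" "card A * card K = order G"
    and "\<And>a a'. \<lbrakk>a \<in> A; a' \<in> A; inv a \<otimes> a' \<in> K\<rbrakk> \<Longrightarrow> a = a'"
  shows "left_factor G A"
proof -
  interpret K: subgroup K G by fact
  let ?f = "\<lambda>(a, k). a \<otimes> k"
  have uniq: "a = a' \<and> k = k'"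
    if *: "a \<in> A" "k \<in> K" "a' \<in> A" "k' \<in> K" "a \<otimes> k = a' \<otimes> k'" for a k a' k'
  proof -
    have G: "a \<in> carrier G" "a' \<in> carrier G" using * assms(3) by auto
    have "inv a \<otimes> a' = k \<otimes> inv k'"
    proof -
      have "a' = a \<otimes> k \<otimes> inv k'"
        using * G inv_solve_right[of a' "a \<otimes> k" k'] by simp
      then show ?thesis
        using *(2,4) G inv_solve_left'[of "k \<otimes> inv k'" a a'] by (simp add: m_assoc)
    qed
    then have "a = a'" using assms(5) * by simp
    then show ?thesis using * G by simp
  qed
  have "card (?f ` (A \<times> K)) = order G"
    using uniq assms(4) by (subst card_image) (auto simp: inj_on_def card_cartesian_product)
  moreover have "?f ` (A \<times> K) \<subseteq> carrier G" using assms(3) by auto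
  ultimately have "?f ` (A \<times> K) = carrier G"
    using assms(1) by (metis card_subset_eq order_def)
  then have "x \<in> ?f ` (A \<times> K)" if "x \<in> carrier G" for x
    using that by simp
  then have "\<exists>a\<in>A. \<exists>k\<in>K. x = a \<otimes> k" if "x \<in> carrier G" for x
    using that by fast
  then have "factorization G A K"
    using uniq assms(3) by (intro factorizationI) auto
  then show ?thesis
    unfolding left_factor_def using assms(3) K.subset by blast
qed

lemma left_factor_translate:
  assumes "a \<in> carrier G" "A \<subseteq> carrier G" "left_factor G ((\<lambda>x. a \<otimes> x) ` A)"
  shows "left_factor G A"
proof -
  obtain B where B: "B \<subseteq> carrier G" "factorization G ((\<lambda>x. a \<otimes> x) ` A) B"
    using assms(3) by (auto simp: left_factor_def)
  have "factorization G A B"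
  proof (rule factorizationI)
    fix x assume x: "x \<in> carrier G"
    obtain y b where yb: "y \<in> A" "b \<in> B" "a \<otimes> x = a \<otimes> y \<otimes> b"
      using factorization_exists[OF B(2), of "a \<otimes> x"] x assms(1) by (metis imageE m_closed)
    then have "y \<in> carrier G" "b \<in> carrier G" using assms(2) B(1) by auto
    then have "x = y \<otimes> b"
      using yb(3) assms(1) x by (simp add: m_assoc)
    then show "\<exists>y\<in>A. \<exists>b\<in>B. x = y \<otimes> b" using yb by blast
  next
    fix x b x' b' assume *: "x \<in> A" "b \<in> B" "x' \<in> A" "b' \<in> B" "x \<otimes> b = x' \<otimes> b'"
    then have G: "x \<in> carrier G" "b \<in> carrier G" "x' \<in> carrier G" "b' \<in> carrier G"
      using assms(2) B(1) by auto
    have "a \<otimes> x \<otimes> b = a \<otimes> x' \<otimes> b'"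
      using * G assms(1) by (simp add: m_assoc)
    then have "a \<otimes> x = a \<otimes> x' \<and> b = b'"
      using factorization_unique[OF B(2)] * by blast
    then show "x = x' \<and> b = b'" using G assms(1) by simp
  qed (use assms(2) B(1) in auto)
  then show ?thesis unfolding left_factor_def using B(1) assms(2) by blast
qed

text \<open>Being a left factor is invariant under left translation, so subsets containing \<open>\<one>\<close> suffice;
  those with one element or all elements are subgroups.\<close>

lemma strong_CFSI:
  assumes "finite (carrier G)"
    and "\<And>A. \<lbrakk>A \<subseteq> carrier G; \<one> \<in> A; card A dvd order G; card A \<noteq> 1; card A \<noteq> order G\<rbrakk>
      \<Longrightarrow> left_factor G A"
  shows "strong_CFS G"
  unfolding strong_CFS_def
proof (intro allI impI)
  fix A assume "Lagrange_subset G A"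
  then have A: "A \<subseteq> carrier G" "card A dvd order G" by (auto simp: Lagrange_subset_def)
  have "order G > 0" using assms(1) by (simp add: order_gt_0_iff_finite)
  then have "A \<noteq> {}" using A by auto
  then obtain a where a: "a \<in> A" by auto
  then have aG: "a \<in> carrier G" using A by auto
  let ?A = "(\<lambda>x. inv a \<otimes> x) ` A"
  have AG: "?A \<subseteq> carrier G" using A aG by auto
  have "inj_on (\<lambda>x. inv a \<otimes> x) A"
    using A aG by (auto simp: inj_on_def subset_iff)
  then have card: "card ?A = card A" by (rule card_image)
  have one: "\<one> \<in> ?A" using a aG by (auto simp: image_iff intro!: bexI[of _ a])
  consider "card A = 1" | "card A = order G" | "card A \<noteq> 1" "card A \<noteq> order G" by blast
  then have "left_factor G ?A"
  proof cases
    case 1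
    then have "?A = {\<one>}"
      using card one by (metis card_1_singletonE singletonD)
    then show ?thesis using left_factor_subgroup[OF triv_subgroup] by simp
  next
    case 2
    then have "?A = carrier G"
      using card AG assms(1) by (metis card_subset_eq order_def)
    then show ?thesis using left_factor_subgroup[OF subgroup_self] by simp
  next
    case 3
    then show ?thesis using assms(2)[OF AG one] A(2) card by simp
  qed
  then have "left_factor G A"
    using left_factor_translate[of "inv a" A] aG A(1) by simp
  then show "group_factor G A" by (simp add: group_factor_def)
qed

lemma prime_order_strong_CFS:
  assumes "finite (carrier G)" "order G = 1 \<or> Factorial_Ring.prime (order G)"
  shows "strong_CFS G"
  using assms by (intro strong_CFSI) (auto simp: prime_nat_iff)

lemma left_factor_involution_pair:
  assumes "x \<in> carrier G" "x \<otimes> x = \<one>"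
  shows "left_factor G {\<one>, x}"
  using left_factor_subgroup[OF subgroup_two] assms by blast

lemma card_2_insert_one:
  assumes "card A = 2" "\<one> \<in> A" "A \<subseteq> carrier G"
  obtains x where "A = {\<one>, x}" "x \<noteq> \<one>" "x \<in> carrier G"
  using assms by (auto simp: card_2_iff)

text \<open>A pair \<open>{\<one>, x}\<close> is a subgroup or, if \<open>x\<close> has order 4, a transversal of \<open>{\<one>, x \<otimes> x}\<close>.\<close>

lemma order_4_strong_CFS:
  assumes "finite (carrier G)" "order G = 4"
  shows "strong_CFS G"
proof (rule strong_CFSI[OF assms(1)])
  fix A assume A: "A \<subseteq> carrier G" "\<one> \<in> A" "card A dvd order G" "card A \<noteq> 1" "card A \<noteq> order G"
  have "card A \<le> 4" using A(3) assms(2) by (simp add: dvd_imp_le)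
  then have "card A \<in> {0,1,2,3,4}" by auto
  then have "card A = 2" using A(3-5) assms(2) by auto
  then obtain x where x: "A = {\<one>, x}" "x \<noteq> \<one>" "x \<in> carrier G"
    using card_2_insert_one A by metis
  show "left_factor G A"
  proof (cases "x \<otimes> x = \<one>")
    case True
    then show ?thesis using left_factor_involution_pair x by simp
  next
    case False
    have "x [^] (4::nat) = \<one>" using pow_order_eq_1[OF x(3)] assms(2) by simp
    then have "(x \<otimes> x) \<otimes> (x \<otimes> x) = \<one>"
      using x(3) by (simp add: numeral_eq_Suc m_assoc)
    then have K: "subgroup {\<one>, x \<otimes> x} G" using subgroup_two x(3) by simp
    have "inv x \<noteq> x \<otimes> x"
    proof
      assume "inv x = x \<otimes> x"
      then have "x \<otimes> (x \<otimes> x) = \<one>" using x(3) by (metis r_inv)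
      then have "x = \<one>" using \<open>(x \<otimes> x) \<otimes> (x \<otimes> x) = \<one>\<close> x(3) by (simp add: m_assoc)
      then show False using x(2) by simp
    qed
    then show ?thesis
      using x False assms by (intro left_factor_transversal[OF assms(1) K]) auto
  qed
qed

text \<open>The group is a vector space over the field with two elements. A set \<open>{\<one>, x, y, z}\<close> is a
  plane, or \<open>x, y, z\<close> is a basis. In the second case the set is a transversal of the line spanned
  by \<open>x \<otimes> y \<otimes> z\<close>, since this vector is not the sum of two elements of the set.\<close>

lemma order_8_elementary_strong_CFS:
  assumes "finite (carrier G)" "order G = 8" and sq: "\<And>x. x \<in> carrier G \<Longrightarrow> x \<otimes> x = \<one>"
  shows "strong_CFS G"
proof (rule strong_CFSI[OF assms(1)])
  fix A assume A: "A \<subseteq> carrier G" "\<one> \<in> A" "card A dvd order G" "card A \<noteq> 1" "card A \<noteq> order G"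
  note comm = involutions_commute[OF sq]
  have i: "inv x = x" if "x \<in> carrier G" for x using that sq inv_equality by blast
  have "card A \<le> 8" using A(3) assms(2) by (simp add: dvd_imp_le)
  then have "card A \<in> {0,1,2,3,4,5,6,7,8}" by auto
  then have "card A = 2 \<or> card A = 4" using A(3-5) assms(2) by auto
  then show "left_factor G A"
  proof
    assume "card A = 2"
    then obtain x where "A = {\<one>, x}" "x \<in> carrier G"
      using card_2_insert_one A by metis
    then show ?thesis using left_factor_involution_pair sq by simp
  next
    assume c4: "card A = 4"
    then have "card (A - {\<one>}) = 3" using A(2) by simp
    then obtain x y z where xyz: "A - {\<one>} = {x, y, z}" "x \<noteq> y" "x \<noteq> z" "y \<noteq> z"
      by (auto simp: card_3_iff)
    then have Aeq: "A = {\<one>, x, y, z}" using A(2) by blast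
    have ne: "x \<noteq> \<one>" "y \<noteq> \<one>" "z \<noteq> \<one>" using xyz by auto
    have G: "x \<in> carrier G" "y \<in> carrier G" "z \<in> carrier G" using A(1) Aeq by auto
    show ?thesis
    proof (cases "z = x \<otimes> y")
      case True
      then show ?thesis
        using left_factor_subgroup[OF subgroup_klein[of x y]] G sq comm Aeq by auto
    next
      case False
      let ?w = "x \<otimes> y \<otimes> z"
      have w: "?w \<in> carrier G" using G by simp
      interpret comm_group G by (rule group_comm_groupI) (rule comm)
      have eqI: "a = b" if "a \<otimes> b = \<one>" "a \<in> carrier G" "b \<in> carrier G" for a b
        using that i inv_equality by metis
      have "?w \<noteq> \<one>"
        using eqI[of "x \<otimes> y" z] False G by auto
      moreover have "?w \<noteq> x"
        using eqI[of y z] xyz G by (auto simp: m_assoc)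
      moreover have "?w \<noteq> y"
        using eqI[of x z] xyz G by (auto simp: m_assoc m_lcomm[of x y])
      moreover have "?w \<noteq> z"
        using eqI[of x y] xyz G by auto
      moreover have "?w \<noteq> x \<otimes> y"
        using ne G by simp
      moreover have "?w \<noteq> x \<otimes> z" "?w \<noteq> y \<otimes> z"
        using ne G by (auto simp: m_assoc)
      moreover have "y \<otimes> x = x \<otimes> y" "z \<otimes> x = x \<otimes> z" "z \<otimes> y = y \<otimes> z"
        using comm G by auto
      ultimately have notw: "a \<otimes> a' \<noteq> ?w" if "a \<in> A" "a' \<in> A" for a a'
        using that G w sq unfolding Aeq by (elim insertE emptyE) simp_all
      show ?thesis
      proof (rule left_factor_transversal[OF assms(1) subgroup_two[OF w sq[OF w]] A(1)])
        show "card A * card {\<one>, ?w} = order G"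
          using c4 assms(2) \<open>?w \<noteq> \<one>\<close> by simp
        fix a a' assume *: "a \<in> A" "a' \<in> A" "inv a \<otimes> a' \<in> {\<one>, ?w}"
        then have "a \<otimes> a' = \<one>"
          using notw i A(1) by (metis insertE singletonD subsetD)
        then show "a = a'" using eqI * A(1) by blast
      qed
    qed
  qed
qed

text \<open>The group is a vector space over the field with three elements. A set \<open>{\<one>, x, y}\<close> is a
  line, or \<open>x, y\<close> is a basis. In the second case the set is a transversal of the line spanned by
  \<open>x \<otimes> y\<close>, since this vector is not the difference of two elements of the set.\<close>

lemma order_9_elementary_strong_CFS:
  assumes "finite (carrier G)" "order G = 9"
    and cube: "\<And>x. x \<in> carrier G \<Longrightarrow> x \<otimes> (x \<otimes> x) = \<one>"
    and comm: "\<And>x y. \<lbrakk>x \<in> carrier G; y \<in> carrier G\<rbrakk> \<Longrightarrow> x \<otimes> y = y \<otimes> x"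
  shows "strong_CFS G"
proof (rule strong_CFSI[OF assms(1)])
  fix A assume A: "A \<subseteq> carrier G" "\<one> \<in> A" "card A dvd order G" "card A \<noteq> 1" "card A \<noteq> order G"
  have "card A \<le> 9" using A(3) assms(2) by (simp add: dvd_imp_le)
  then have "card A \<in> {0,1,2,3,4,5,6,7,8,9}" by auto
  then have c3: "card A = 3" using A(3-5) assms(2) by auto
  then have "card (A - {\<one>}) = 2" using A(2) by simp
  then obtain x y where xy: "A - {\<one>} = {x, y}" "x \<noteq> y"
    by (auto simp: card_2_iff)
  then have Aeq: "A = {\<one>, x, y}" using A(2) by blast
  have ne: "x \<noteq> \<one>" "y \<noteq> \<one>" using xy by auto
  have G: "x \<in> carrier G" "y \<in> carrier G" using A(1) Aeq by auto
  show "left_factor G A"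
  proof (cases "y = x \<otimes> x")
    case True
    then show ?thesis
      using left_factor_subgroup[OF subgroup_three[of x]] G cube Aeq by auto
  next
    case False
    interpret comm_group G by (rule group_comm_groupI) (rule comm)
    let ?w = "x \<otimes> y"
    have w: "?w \<in> carrier G" using G by simp
    have double: "b = a \<otimes> a" if "a \<otimes> b = \<one>" "a \<in> carrier G" "b \<in> carrier G" for a b
      using that cube by (metis l_cancel m_closed)
    have nsq: "a \<otimes> a \<noteq> \<one>" if "a \<noteq> \<one>" "a \<in> carrier G" for a
      using that cube by fastforce
    have w1: "?w \<noteq> \<one>"
      using double False G by blast
    have xxy: "x \<otimes> ?w \<noteq> \<one>" "y \<otimes> ?w \<noteq> \<one>"
      using cube[of x] cube[of y] xy(2) G comm by (metis l_cancel m_assoc m_closed)+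
    have notw: "a \<otimes> ?w \<noteq> a'" if "a \<in> A" "a' \<in> A" for a a'
    proof -
      have "x \<otimes> ?w \<noteq> y"
        using nsq[OF ne(1) G(1)] G by (simp add: m_assoc[symmetric])
      moreover have "y \<otimes> ?w \<noteq> x"
        using nsq[OF ne(2) G(2)] G by (simp add: m_lcomm[of y x])
      moreover have "y \<otimes> ?w \<noteq> y" "x \<otimes> ?w \<noteq> x" "?w \<noteq> x" "?w \<noteq> y"
        using w1 w ne G by simp_all
      ultimately show ?thesis
        using that w1 xxy w unfolding Aeq by (elim insertE emptyE) simp_all
    qed
    show ?thesis
    proof (rule left_factor_transversal[OF assms(1) subgroup_three[OF w cube[OF w]] A(1)])
      have "?w \<otimes> ?w \<noteq> \<one>" "?w \<otimes> ?w \<noteq> ?w"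
        using nsq[OF w1 w] w1 w by simp_all
      then have "card {\<one>, ?w, ?w \<otimes> ?w} = 3" using w1 by auto
      then show "card A * card {\<one>, ?w, ?w \<otimes> ?w} = order G"
        using c3 assms(2) by simp
      fix a a' assume *: "a \<in> A" "a' \<in> A" "inv a \<otimes> a' \<in> {\<one>, ?w, ?w \<otimes> ?w}"
      have aG: "a \<in> carrier G" "a' \<in> carrier G" using * A(1) by auto
      consider "inv a \<otimes> a' = \<one>" | "inv a \<otimes> a' = ?w" | "inv a \<otimes> a' = ?w \<otimes> ?w"
        using *(3) by blast
      then show "a = a'"
      proof cases
        case 1
        then show ?thesis using aG by (simp add: inv_solve_left')
      next
        case 2
        then have "a' = a \<otimes> ?w" using aG w by (simp add: inv_solve_left')
        then show ?thesis using notw * by blast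
      next
        case 3
        \<comment> \<open>\<open>?w \<otimes> ?w\<close> is the inverse of \<open>?w\<close>, so \<open>a\<close> and \<open>a'\<close> change places.\<close>
        then have "a' = a \<otimes> (?w \<otimes> ?w)" using aG w by (simp add: inv_solve_left')
        then have "a' \<otimes> ?w = a \<otimes> (?w \<otimes> (?w \<otimes> ?w))" using aG w by (metis m_assoc m_closed)
        then have "a = a' \<otimes> ?w" using cube[OF w] aG by simp
        then show ?thesis using notw * by blast
      qed
    qed
  qed
qed

end

section \<open>Transfer along isomorphisms and the classification\<close>

lemma iso_pow_eq_one:
  assumes "group G" "G \<cong> K" "group K" and K: "\<And>k. k \<in> carrier K \<Longrightarrow> k [^]\<^bsub>K\<^esub> (n::nat) = \<one>\<^bsub>K\<^esub>"
    and "x \<in> carrier G"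
  shows "x [^]\<^bsub>G\<^esub> n = \<one>\<^bsub>G\<^esub>"
proof -
  obtain f where f: "f \<in> iso G K" using assms(2) by (auto simp: is_iso_def)
  then have hom: "f \<in> hom G K" and inj: "inj_on f (carrier G)"
    by (auto simp: iso_def bij_betw_def)
  have "f (x [^]\<^bsub>G\<^esub> n) = f \<one>\<^bsub>G\<^esub>"
    using hom_nat_pow[OF hom assms(5,1,3)] K hom assms(1,3,5)
    by (simp add: hom_one hom_carrier[THEN subsetD])
  then show ?thesis
    using inj assms(1,5) by (metis inj_onD group.is_monoid monoid.nat_pow_closed monoid.one_closed)
qed

lemma pow_DirProd:
  "(x, y) [^]\<^bsub>G \<times>\<times> H\<^esub> (n::nat) = (x [^]\<^bsub>G\<^esub> n, y [^]\<^bsub>H\<^esub> n)"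
  by (induction n) simp_all

lemma DirProd_comm_group:
  assumes "comm_group G" "comm_group H"
  shows "comm_group (G \<times>\<times> H)"
proof -
  interpret G: comm_group G by fact
  interpret H: comm_group H by fact
  show ?thesis
    by (rule group.group_comm_groupI[OF DirProd_group[OF G.is_group H.is_group]])
      (auto simp: G.m_comm H.m_comm)
qed

lemma order_iso: "G \<cong> K \<Longrightarrow> order G = order K"
  by (simp add: order_def iso_same_card)

lemma order_integer_mod_group: "n > 0 \<Longrightarrow> order (integer_mod_group n) = n"
  by (simp add: order_def carrier_integer_mod_group)

theorem theorem2p1:
  fixes G :: "('a, 'b) monoid_scheme"
  assumes "group G" and "finite (carrier G)"
  shows "strong_CFS G \<longleftrightarrow>
           trivial_group G \<or>
           (\<exists>p::nat. Factorial_Ring.prime p \<and> G \<cong> integer_mod_group p) \<or>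
           G \<cong> integer_mod_group 2 \<times>\<times> integer_mod_group 2 \<or>
           G \<cong> integer_mod_group 4 \<or>
           G \<cong> integer_mod_group 2 \<times>\<times> integer_mod_group 2 \<times>\<times> integer_mod_group 2 \<or>
           G \<cong> integer_mod_group 3 \<times>\<times> integer_mod_group 3"
    (is "_ \<longleftrightarrow> _ \<or> _ \<or> G \<cong> ?K4 \<or> _ \<or> G \<cong> ?K8 \<or> G \<cong> ?K9")
proof -
  interpret group G by fact
  show ?thesis
  proof
    assume CFS: "strong_CFS G"
    from strong_CFS_order[OF CFS assms(2)] consider "order G = 1" | "Factorial_Ring.prime (order G)"
      | "order G = 4" | "order G = 8" | "order G = 9" by auto
    then show "trivial_group G \<or> (\<exists>p::nat. Factorial_Ring.prime p \<and> G \<cong> integer_mod_group p) \<or>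
      G \<cong> ?K4 \<or> G \<cong> integer_mod_group 4 \<or> G \<cong> ?K8 \<or> G \<cong> ?K9"
    proof cases
      case 1
      then show ?thesis by (auto simp: trivial_group order_def card_1_singleton_iff)
    next
      case 2
      then show ?thesis using prime_order_iso[OF assms(2)] by blast
    next
      case 3
      then show ?thesis using order_4_iso[OF assms(2)] by blast
    next
      case 4
      then show ?thesis
        using order_8_elementary_iso[OF assms(2)] strong_CFS_order_8_exponent[OF CFS assms(2)] by blast
    next
      case 5
      then show ?thesis using strong_CFS_order_9_iso[OF CFS assms(2)] by blast
    qed
  next
    have K: "order ?K4 = 4" "order ?K8 = 8" "order ?K9 = 9"
      by (simp_all add: order_def card_cartesian_product carrier_integer_mod_group)
    have grp: "group ?K8" "group ?K9"
      by (simp_all add: DirProd_group)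
    assume "trivial_group G \<or> (\<exists>p::nat. Factorial_Ring.prime p \<and> G \<cong> integer_mod_group p) \<or>
      G \<cong> ?K4 \<or> G \<cong> integer_mod_group 4 \<or> G \<cong> ?K8 \<or> G \<cong> ?K9"
    then consider "trivial_group G"
      | p :: nat where "Factorial_Ring.prime p" "G \<cong> integer_mod_group p"
      | "G \<cong> ?K4 \<or> G \<cong> integer_mod_group 4" | "G \<cong> ?K8" | "G \<cong> ?K9" by blast
    then show "strong_CFS G"
    proof cases
      case 1
      then have "order G = 1" by (auto simp: trivial_group order_def)
      then show ?thesis using prime_order_strong_CFS[OF assms(2)] by blast
    next
      case 2
      then have "order G = p"
        using order_iso order_integer_mod_group prime_gt_0_nat by metis
      then show ?thesis using 2 prime_order_strong_CFS[OF assms(2)] by blast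
    next
      case 3
      then have "order G = 4"
        using order_iso[of G ?K4] order_iso[of G "integer_mod_group 4"] K(1)
          order_integer_mod_group[of 4] by auto
      then show ?thesis by (rule order_4_strong_CFS[OF assms(2)])
    next
      case 4
      have "k [^]\<^bsub>?K8\<^esub> (2::nat) = \<one>\<^bsub>?K8\<^esub>" if "k \<in> carrier ?K8" for k
        using that by (cases k rule: prod_cases3) (simp add: pow_DirProd DirProd_group)
      then have "x [^]\<^bsub>G\<^esub> (2::nat) = \<one>\<^bsub>G\<^esub>" if "x \<in> carrier G" for x
        using iso_pow_eq_one[OF assms(1) 4 grp(1) _ that] by blast
      then have "x \<otimes>\<^bsub>G\<^esub> x = \<one>\<^bsub>G\<^esub>" if "x \<in> carrier G" for x
        using that by (simp add: numeral_2_eq_2)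
      then show ?thesis
        using order_8_elementary_strong_CFS[OF assms(2)] order_iso[OF 4] K(2) by simp
    next
      case 5
      have "k [^]\<^bsub>?K9\<^esub> (3::nat) = \<one>\<^bsub>?K9\<^esub>" if "k \<in> carrier ?K9" for k
        using that by (cases k) (simp add: pow_DirProd)
      then have "x [^]\<^bsub>G\<^esub> (3::nat) = \<one>\<^bsub>G\<^esub>" if "x \<in> carrier G" for x
        using iso_pow_eq_one[OF assms(1) 5 grp(2) _ that] by blast
      then have "x \<otimes>\<^bsub>G\<^esub> (x \<otimes>\<^bsub>G\<^esub> x) = \<one>\<^bsub>G\<^esub>" if "x \<in> carrier G" for x
        using that by (simp add: numeral_3_eq_3 m_assoc)
      moreover have "comm_group G"
        using comm_group.iso_imp_comm_group[OF _ _ is_monoid, of ?K9] iso_sym[OF 5]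
          DirProd_comm_group[OF abelian_integer_mod_group abelian_integer_mod_group] by blast
      ultimately show ?thesis
        using order_9_elementary_strong_CFS[OF assms(2)] order_iso[OF 5] K(3)
        by (simp add: comm_groupE(4))
    qed
  qed
qed

end
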